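(* Let $g\ge 0$ and $\gamma_x,\gamma_z\in\mathbb R$, let $H$ be the spin-1 Hamiltonian $$H=\hbar\left(g\tilde S_z+\gamma_x\tilde S_x^2+\gamma_z\tilde S_z^2\right),$$ with eigenvalues $\epsilon_1\ge\epsilon_2\ge\epsilon_3$, let $T>0$ and let $\rho_S=e^{-H/k_BT}/\mathrm{Tr}(e^{-H/k_BT})$ be the thermal state at temperature $T$. Then $\rho_S$ is symmetric absolutely separable if and only if $$2\epsilon_3-\epsilon_1-\epsilon_2+2k_BT\ln 2\ge 0.$$ Explicitly, for $g=0$ this condition reads: (a) $\hbar(\gamma_x+\gamma_z)+2k_BT\ln2\ge0$ if $\gamma_x,\gamma_z\le0$; (b) $\hbar(\gamma_z-2\gamma_x)+2k_BT\ln2\ge0$ if $0\le\gamma_z\le\gamma_x$ or $\gamma_z\le0\le\gamma_x$; (c) $\hbar(\gamma_x-2\gamma_z)+2k_BT\ln2\ge0$ if $0\le\gamma_x\le\gamma_z$ or $\gamma_x\le0\le\gamma_z$. For $g\neq0$ it reads: (d) $\hbar(\gamma_x-2\gamma_z)+2k_BT\ln2\ge0$ if $g^2\le\gamma_z(\gamma_z-\gamma_x)$ and $\gamma_x<2\gamma_z$; (e) $\hbar\left(2\gamma_z-\gamma_x-3\sqrt{4g^2+\gamma_x^2}\right)+4k_BT\ln2\ge0$ if $g^2\ge\gamma_z(\gamma_z-\gamma_x)$ or $2\gamma_z<\gamma_x$. In particular, for any values of $(g,\gamma_x,\gamma_z)$ there exists a critical temperature $T_c\ge 0$ above which the thermal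 state is symmetric absolutely separable.
   Context: $\tilde S_x,\tilde S_y,\tilde S_z$ are the standard dimensionless spin-1 angular momentum operators on $\mathbb C^3$ (with $\tilde S_z$ having eigenvalues $1,0,-1$); $\hbar,k_B>0$ are constants. The spin-1 Hilbert space $\mathbb C^3$ is identified with the symmetric subspace $(\mathbb C^2)^{\vee2}$ of two qubits (the vectors of $\mathbb C^2\otimes\mathbb C^2$ invariant under exchange) by sending the $\tilde S_z$-eigenvectors with eigenvalues $1,0,-1$ to $|+\rangle|+\rangle$, $\frac1{\sqrt2}(|+\rangle|-\rangle+|-\rangle|+\rangle)$, $|-\rangle|-\rangle$, where $|+\rangle,|-\rangle$ is an orthonormal basis of $\mathbb C^2$. A two-qubit state is separable if it is a convex combination of projectors onto product states. A density operator $\rho_S$ on $(\mathbb C^2)^{\vee 2}$ is symmetric absolutely separable (SAS) if $U_S\rho_SU_S^\dagger$ is separable for every $U_S\in SU(3)$, the special unitary group of $(\mathbb C^2)^{\vee 2}\simeq\mathbb C^3$. *)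

theory Defs
  imports "HOL-Analysis.Analysis"
begin

definition adj :: "complex^'n^'m \<Rightarrow> complex^'m^'n" where
  "adj A = (\<chi> i j. cnj (A $ j $ i))"

(* The type constructor vec has no instance for the matrix product, so the library's
   exp is not the matrix exponential; it is defined here by its power series. *)
primrec mat_power :: "complex^'n^'n \<Rightarrow> nat \<Rightarrow> complex^'n^'n" where
  "mat_power A 0 = mat 1"
| "mat_power A (Suc k) = A ** mat_power A k"

definition mat_exp :: "complex^'n^'n \<Rightarrow> complex^'n^'n" where
  "mat_exp A = (\<Sum>k. (1 / fact k) *\<^sub>R mat_power A k)"

definition density_operator :: "complex^'n^'n \<Rightarrow> bool" where
  "density_operator \<rho> \<longleftrightarrow>
     adj \<rho> = \<rho> \<and>
     (\<forall>v. 0 \<le> Re (\<Sum>i\<in>UNIV. cnj (v $ i) * (\<rho> *v v) $ i)) \<and>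
     trace \<rho> = 1"

(* The real numbers e1 >= e2 >= e3 are the eigenvalues of A, repeated according to
   their multiplicity as roots of the characteristic polynomial. *)
definition ordered_eigenvalues :: "complex^3^3 \<Rightarrow> real \<Rightarrow> real \<Rightarrow> real \<Rightarrow> bool" where
  "ordered_eigenvalues A e1 e2 e3 \<longleftrightarrow>
     e1 \<ge> e2 \<and> e2 \<ge> e3 \<and>
     (\<forall>x. det (mat x - A) =
           (x - complex_of_real e1) * (x - complex_of_real e2) * (x - complex_of_real e3))"

(* Spin-1 operators in the S_z-eigenbasis, ordered by the eigenvalues 1, 0, -1. *)
definition spin_x :: "complex^3^3" where
  "spin_x = (1 / sqrt 2) *\<^sub>R vector [vector [0, 1, 0], vector [1, 0, 1], vector [0, 1, 0]]"

definition spin_z :: "complex^3^3" where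
  "spin_z = vector [vector [1, 0, 0], vector [0, 0, 0], vector [0, 0, -1]]"

definition hamiltonian :: "real \<Rightarrow> real \<Rightarrow> real \<Rightarrow> real \<Rightarrow> complex^3^3" where
  "hamiltonian hbar g \<gamma>x \<gamma>z =
     hbar *\<^sub>R (g *\<^sub>R spin_z + \<gamma>x *\<^sub>R (spin_x ** spin_x) + \<gamma>z *\<^sub>R (spin_z ** spin_z))"

definition thermal_state :: "complex^'n^'n \<Rightarrow> real \<Rightarrow> real \<Rightarrow> complex^'n^'n" where
  "thermal_state H kB T =
     (let E = mat_exp ((- 1 / (kB * T)) *\<^sub>R H) in \<chi> i j. E $ i $ j / trace E)"

(* The two-qubit space is represented by complex vectors indexed by pairs. *)
definition tensor :: "complex^2 \<Rightarrow> complex^2 \<Rightarrow> complex^(2 \<times> 2)" where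
  "tensor \<phi> \<psi> = (\<chi> p. \<phi> $ fst p * \<psi> $ snd p)"

definition projector :: "complex^'n \<Rightarrow> complex^'n^'n" where
  "projector \<psi> = (\<chi> i j. \<psi> $ i * cnj (\<psi> $ j))"

definition separable :: "complex^(2 \<times> 2)^(2 \<times> 2) \<Rightarrow> bool" where
  "separable \<sigma> \<longleftrightarrow>
     \<sigma> \<in> convex hull {projector (tensor \<phi> \<psi>) | \<phi> \<psi>. norm \<phi> = 1 \<and> norm \<psi> = 1}"

definition ket_plus :: "complex^2" where
  "ket_plus = axis 1 1"

definition ket_minus :: "complex^2" where
  "ket_minus = axis 2 1"

(* The isometry from the spin-1 space onto the symmetric two-qubit vectors; its columns
   are the images of the S_z-eigenvectors. *)
definition sym_isometry :: "complex^3^(2 \<times> 2)" where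
  "sym_isometry = transpose (vector
     [tensor ket_plus ket_plus,
      (1 / sqrt 2) *\<^sub>R (tensor ket_plus ket_minus + tensor ket_minus ket_plus),
      tensor ket_minus ket_minus])"

(* The two-qubit operator supported on the symmetric subspace that corresponds to a
   spin-1 operator. *)
definition two_qubit :: "complex^3^3 \<Rightarrow> complex^(2 \<times> 2)^(2 \<times> 2)" where
  "two_qubit \<rho> = sym_isometry ** \<rho> ** adj sym_isometry"

definition SU :: "(complex^'n^'n) set" where
  "SU = {U. U ** adj U = mat 1 \<and> adj U ** U = mat 1 \<and> det U = 1}"

definition sym_abs_separable :: "complex^3^3 \<Rightarrow> bool" where
  "sym_abs_separable \<rho> \<longleftrightarrow>
     density_operator \<rho> \<and> (\<forall>U\<in>SU. separable (two_qubit (U ** \<rho> ** adj U)))"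

end

(* For a spin-1 state with eigenvalues l1, l2, l3 > 0, absolute separability amounts to
   l_i^3 <= 4 l1 l2 l3 for all i; with Boltzmann weights and the smallest energy this is the claimed
   linear inequality after taking logarithms.

   Necessity: a unitary puts the state into the form diag(l_j, l_i, l_k) in the S_z-basis, and the
   partial transpose then has the block [[l_j, l_i/2], [l_i/2, l_k]], which must be positive.

   Sufficiency: write the rotated state as A A^*. A vector z is spin coherent (a symmetric product
   state) iff q(z) = z_2^2 - 2 z_1 z_3 = 0. A Takagi factorization of q pulled back by A gives an
   orthonormal basis x_k with q(A x_i, A x_j) = c_i delta_ij. The largest |c_1| is at most max l, and
   |c_1 c_2 c_3| = |det A|^2 = l1 l2 l3, so by AM-GM |c_1| <= |c_2| + |c_3|. Hence there are phases
   with u_1^2 c_1 + u_2^2 c_2 + u_3^2 c_3 = 0, and the four vectors A(u_1 x_1 +- u_2 x_2 +- u_3 x_3)/2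
   are coherent and decompose A A^*, as in Wootters' construction. *)

theory Submission
  imports Defs
begin

section \<open>Adjoints, diagonal matrices and projectors\<close>

definition diag_mat :: "('n \<Rightarrow> complex) \<Rightarrow> complex^'n^'n" where
  "diag_mat d = (\<chi> i j. if i = j then d i else 0)"

lemma adj_mult: "adj (A ** B) = adj B ** adj A"
  by (simp add: adj_def matrix_matrix_mult_def vec_eq_iff mult.commute)

lemma adj_adj [simp]: "adj (adj A) = A"
  by (simp add: adj_def vec_eq_iff)

lemma det_adj: "det (adj A) = cnj (det A)" for A :: "complex^3^3"
  by (simp add: det_3 adj_def)

lemma congruence_projector: "M ** projector z ** adj M = projector (M *v z)"
  by (simp add: vec_eq_iff projector_def matrix_matrix_mult_def matrix_vector_mult_def adj_def
      sum_distrib_left sum_distrib_right mult_ac)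

lemma diag_mat_conj_entry:
  "(V ** diag_mat d ** adj V) $ i $ j = (\<Sum>k\<in>UNIV. d k * (V $ i $ k * cnj (V $ j $ k)))"
  by (simp add: diag_mat_def matrix_matrix_mult_def adj_def if_distrib cong: if_cong)
   (simp add: mult_ac)

lemma diag_mat_mult: "diag_mat d ** diag_mat e = diag_mat (\<lambda>i. d i * e i)"
  by (simp add: vec_eq_iff diag_mat_def matrix_matrix_mult_def mult_delta_left mult_delta_right if_distrib[of "\<lambda>x. d _ * x"] cong: if_cong)

lemma norm_vec_sq: "(norm z)\<^sup>2 = (\<Sum>i\<in>UNIV. (cmod (z $ i))\<^sup>2)" for z :: "complex^'n"
  by (simp add: norm_vec_def L2_set_def sum_nonneg)

section \<open>Spin-coherent vectors and mixtures of them\<close>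

lemma spin_coherent:
  assumes "(z $ 2)\<^sup>2 = 2 * z $ 1 * z $ 3"
  obtains \<phi> where "sym_isometry *v z = tensor \<phi> \<phi>"
proof -
  define a b where "a = csqrt (z $ 1)" and "b = csqrt (z $ 3)"
  have s: "complex_of_real (sqrt 2) * complex_of_real (sqrt 2) = 2"
    by (metis abs_numeral of_real_mult of_real_numeral real_sqrt_mult_self)
  then have s2: "(complex_of_real (sqrt 2))\<^sup>2 = 2" by (simp add: power2_eq_square)
  have "(z $ 2)\<^sup>2 = (sqrt 2 * a * b)\<^sup>2"
    using assms by (simp add: a_def b_def power_mult_distrib s2)
  then have "z $ 2 = sqrt 2 * a * b \<or> z $ 2 = - (sqrt 2 * a * b)"
    by (simp add: power2_eq_iff)
  \<comment> \<open>The tensor square of \<open>vector [a, b]\<close> has spin-1 coordinates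
    \<open>a\<^sup>2\<close>, \<open>sqrt 2 * a * b\<close> and \<open>b\<^sup>2\<close>. The outer
    two fix \<open>a\<close> and \<open>b\<close> up to sign; the sign of \<open>b\<close> is
    flipped here if the middle coordinate requires it.\<close>
  then obtain b' where b': "z $ 2 = sqrt 2 * a * b'" "b'\<^sup>2 = z $ 3"
    by (metis b_def minus_mult_right power2_csqrt power2_minus)
  have a: "a\<^sup>2 = z $ 1" by (simp add: a_def)
  have "sym_isometry *v z = tensor (vector [a, b']) (vector [a, b'])"
    using b' a s
    apply (simp add: vec_eq_iff forall_2 matrix_vector_mult_def sym_isometry_def transpose_def tensor_def
        sum_3 vector_3 ket_plus_def ket_minus_def axis_def power2_eq_square split_paired_All)
    apply (simp add: scaleR_conv_of_real field_simps)
    done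
  then show thesis by (rule that)
qed

lemma norm_tensor: "norm (tensor \<phi> \<psi>) = norm \<phi> * norm \<psi>"
proof -
  have "(norm (tensor \<phi> \<psi>))\<^sup>2 = (norm \<phi> * norm \<psi>)\<^sup>2"
    by (simp add: norm_vec_sq tensor_def power_mult_distrib norm_mult sum_product
        sum.cartesian_product flip: UNIV_Times_UNIV)
       (simp add: case_prod_unfold)
  then show ?thesis by (simp add: power2_eq_iff_nonneg)
qed

lemma norm_sym_isometry: "norm (sym_isometry *v z) = norm z"
proof -
  have "(norm (sym_isometry *v z))\<^sup>2 = (norm z)\<^sup>2"
    by (simp add: norm_vec_sq matrix_vector_mult_def sym_isometry_def transpose_def tensor_def
        sum_3 vector_3 ket_plus_def ket_minus_def axis_def sum_2 norm_mult norm_divide power_divide power_mult_distrib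
        sum.cartesian_product[symmetric, of "\<lambda>i j. f (i,j)" for f, simplified] flip: UNIV_Times_UNIV)
  then show ?thesis by (simp add: power2_eq_iff_nonneg)
qed

lemma trace_projector: "trace (projector z) = complex_of_real ((norm z)\<^sup>2)"
  by (simp add: trace_def projector_def norm_vec_sq complex_norm_square flip: of_real_power)

lemma projector_scaleR: "projector (c *\<^sub>R z) = c\<^sup>2 *\<^sub>R projector z"
  by (simp add: vec_eq_iff projector_def power2_eq_square scaleR_conv_of_real[where 'a=complex] mult_ac)

lemma tensor_scaleR: "tensor (c *\<^sub>R x) (d *\<^sub>R y) = (c * d) *\<^sub>R tensor x y"
  by (simp add: vec_eq_iff tensor_def)

lemma matrix_mult_add_left: "(A + B) ** C = A ** C + B ** C" for A B :: "complex^'n^'m"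
  by (simp add: vec_eq_iff matrix_matrix_mult_def sum.distrib distrib_right)

lemma two_qubit_sum: "two_qubit (\<Sum>i\<in>I. f i) = (\<Sum>i\<in>I. two_qubit (f i))"
  by (induction I rule: infinite_finite_induct)
     (simp_all add: two_qubit_def matrix_add_ldistrib matrix_mult_add_left)

lemma trace_sum: "trace (\<Sum>i\<in>I. f i) = (\<Sum>i\<in>I. trace (f i))"
  for f :: "_ \<Rightarrow> complex^'n^'n"
  by (induction I rule: infinite_finite_induct) (simp_all add: trace_add trace_0[simplified])

text \<open>Each \<open>z i\<close> becomes a multiple of a unit product vector, so the squared
  norms serve as convex weights, and the trace condition makes them add up to 1.\<close>

lemma separable_sum_projector:
  assumes "finite I" and q: "\<And>i. i \<in> I \<Longrightarrow> (z i $ 2)\<^sup>2 = 2 * z i $ 1 * z i $ 3"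
    and tr: "trace (\<Sum>i\<in>I. projector (z i)) = 1"
  shows "separable (two_qubit (\<Sum>i\<in>I. projector (z i)))"
proof -
  let ?P = "{projector (tensor \<phi> \<psi>) | \<phi> \<psi>. norm \<phi> = 1 \<and> norm \<psi> = 1}"
  have "\<forall>i\<in>I. \<exists>p. p \<in> ?P \<and> two_qubit (projector (z i)) = (norm (z i))\<^sup>2 *\<^sub>R p"
  proof
    fix i assume i: "i \<in> I"
    obtain \<phi> where \<phi>: "sym_isometry *v z i = tensor \<phi> \<phi>"
      using spin_coherent q[OF i] by metis
    have n: "norm (z i) = norm \<phi> * norm \<phi>"
      using \<phi> norm_sym_isometry norm_tensor by metis
    \<comment> \<open>A zero vector carries weight 0, so any unit vector, here
      \<open>ket_plus\<close>, may stand in for its direction.\<close>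
    define \<xi> where "\<xi> = (if \<phi> = 0 then ket_plus else \<phi> /\<^sub>R norm \<phi>)"
    have "norm \<xi> = 1" by (auto simp: \<xi>_def ket_plus_def)
    have "\<phi> = norm \<phi> *\<^sub>R \<xi>" by (simp add: \<xi>_def)
    then have "two_qubit (projector (z i)) = (norm (z i))\<^sup>2 *\<^sub>R projector (tensor \<xi> \<xi>)"
      by (metis n \<phi> two_qubit_def congruence_projector tensor_scaleR projector_scaleR)
    with \<open>norm \<xi> = 1\<close>
    show "\<exists>p. p \<in> ?P \<and> two_qubit (projector (z i)) = (norm (z i))\<^sup>2 *\<^sub>R p" by blast
  qed
  from bchoice[OF this] obtain p where p: "\<And>i. i \<in> I \<Longrightarrow> p i \<in> ?P"
    "\<And>i. i \<in> I \<Longrightarrow> two_qubit (projector (z i)) = (norm (z i))\<^sup>2 *\<^sub>R p i"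
    by blast
  have "(\<Sum>i\<in>I. (norm (z i))\<^sup>2) = 1"
    using tr by (simp add: trace_sum trace_projector flip: of_real_sum of_real_power)
  moreover have "p i \<in> convex hull ?P" if "i \<in> I" for i
    using p(1)[OF that] by (rule hull_inc)
  ultimately have "(\<Sum>i\<in>I. (norm (z i))\<^sup>2 *\<^sub>R p i) \<in> convex hull ?P"
    by (intro convex_sum \<open>finite I\<close>) simp_all
  then show ?thesis by (simp add: separable_def two_qubit_sum p(2))
qed

section \<open>Two lemmas on moduli and phases of complex numbers\<close>

lemma quadratic_perturbation_zero:
  fixes b c d :: complex and k :: real
  assumes "\<And>t. cmod (c + 2 * t * b + t\<^sup>2 * d) \<le> cmod c * (1 + k * (cmod t)\<^sup>2)"
  shows "b = 0"
proof (cases "c = 0")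
  case True
  then show ?thesis using assms[of 1] assms[of "-1"] by simp
next
  case False
  show ?thesis
  proof (rule ccontr)
    assume "b \<noteq> 0"
    \<comment> \<open>The phase \<open>c * cmod b / (b * cmod c)\<close> turns \<open>t * b\<close>
      into the direction of \<open>c\<close>, so the linear term adds fully to the modulus. The
      length \<open>r\<close> is so small that the quadratic terms use up at most
      \<open>r * cmod b\<close> of the gain \<open>2 * r * cmod b\<close>.\<close>
    define r where "r = cmod b / (cmod c * \<bar>k\<bar> + cmod d + 1)"
    define t where "t = r * (c * cmod b / (b * cmod c))"
    have pos: "cmod c * \<bar>k\<bar> + cmod d + 1 > 0" by (simp add: add_nonneg_pos)
    then have r: "r > 0" using \<open>b \<noteq> 0\<close> by (simp add: r_def)
    have ct: "cmod t = r" using \<open>b \<noteq> 0\<close> False r by (simp add: t_def norm_mult norm_divide)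
    have "c + 2 * t * b = (c / cmod c) * complex_of_real (cmod c + 2 * r * cmod b)"
      using \<open>b \<noteq> 0\<close> False by (simp add: t_def field_simps)
    then have "cmod (c + 2 * t * b) = cmod c + 2 * r * cmod b"
      using False r by (simp add: norm_mult norm_divide del: of_real_add of_real_mult)
    moreover have "cmod (c + 2 * t * b) \<le> cmod (c + 2 * t * b + t\<^sup>2 * d) + cmod (t\<^sup>2 * d)"
      by (metis add_diff_cancel_right' norm_triangle_ineq4)
    ultimately have "2 * r * cmod b \<le> r\<^sup>2 * (cmod c * k + cmod d)"
      using assms[of t] ct by (simp add: norm_mult norm_power algebra_simps)
    also have "\<dots> \<le> r\<^sup>2 * (cmod c * \<bar>k\<bar> + cmod d + 1)"
      using mult_left_mono[OF abs_ge_self[of k] norm_ge_zero[of c]] by (intro mult_left_mono) auto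
    also have "\<dots> = r * cmod b" using pos by (simp add: r_def power2_eq_square)
    finally show False using r \<open>b \<noteq> 0\<close> by simp
  qed
qed

text \<open>Lengths obeying the triangle inequalities are the sides of a closed triangle. With sides
  \<open>cmod c1\<close> and \<open>cmod c2\<close> at a variable angle, the intermediate value
  theorem finds the angle at which the third side has length \<open>cmod c3\<close>.\<close>

lemma triangle_phases:
  fixes c1 c2 c3 :: complex
  assumes "cmod c1 \<le> cmod c2 + cmod c3" "cmod c2 \<le> cmod c1" "cmod c3 \<le> cmod c1"
  obtains u1 u2 u3 where "cmod u1 = 1" "cmod u2 = 1" "cmod u3 = 1"
    "u1\<^sup>2 * c1 + u2\<^sup>2 * c2 + u3\<^sup>2 * c3 = 0"
proof -
  define f where "f = (\<lambda>x::real. cmod (cmod c1 + cis x * cmod c2))"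
  have "f pi \<le> cmod c3"
    using assms by (simp add: f_def flip: of_real_diff)
  moreover have "cmod c3 \<le> f 0"
    using assms(3) norm_ge_zero[of c2] by (simp add: f_def del: norm_ge_zero flip: of_real_add)
  moreover have "continuous_on {0..pi} f"
    unfolding f_def cis_conv_exp by (intro continuous_intros)
  ultimately obtain x where x: "f x = cmod c3"
    using IVT2'[of f pi "cmod c3" 0] by auto
  define w where "w = cmod c1 + cis x * cmod c2"
  have phase: "\<exists>t. cmod t = 1 \<and> t * y = cmod y" for y :: complex
  proof (cases "y = 0")
    case False
    then show ?thesis
      by (intro exI[of _ "cmod y / y"]) (simp add: norm_divide)
  qed (auto intro: exI[of _ 1])
  obtain t1 t2 t3 t4 where t: "cmod t1 = 1" "t1 * c1 = cmod c1" "cmod t2 = 1" "t2 * c2 = cmod c2"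
    "cmod t3 = 1" "t3 * c3 = cmod c3" "cmod t4 = 1" "t4 * w = cmod w"
    using phase by metis
  have w: "w = cmod c3 / t4"
    using t x by (metis f_def w_def nonzero_mult_div_cancel_left norm_zero zero_neq_one)
  have "t1 * c1 + cis x * t2 * c2 + (- t3 / t4) * c3 = 0"
    using w t by (simp add: w_def mult.assoc)
  \<comment> \<open>The phases occur squared in the claim, hence the square roots.\<close>
  then show thesis
    using t by (intro that[of "csqrt t1" "csqrt (cis x * t2)" "csqrt (- t3 / t4)"])
      (auto simp: norm_mult norm_divide)
qed

section \<open>Bilinear and Hermitian forms, and Takagi factorization\<close>

definition cdot :: "complex^'n \<Rightarrow> complex^'n \<Rightarrow> complex" where
  "cdot x y = (\<Sum>i\<in>UNIV. x $ i * y $ i)"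

definition hdot :: "complex^'n \<Rightarrow> complex^'n \<Rightarrow> complex" where
  "hdot x y = (\<Sum>i\<in>UNIV. cnj (x $ i) * y $ i)"

definition bil :: "complex^'n^'n \<Rightarrow> complex^'n \<Rightarrow> complex^'n \<Rightarrow> complex" where
  "bil R x y = cdot x (R *v y)"

lemma cdot_commute: "cdot x y = cdot y x"
  by (simp add: cdot_def mult.commute)

lemma cdot_matrix: "cdot (A *v x) y = cdot x (transpose A *v y)"
proof -
  have "cdot (A *v x) y = (\<Sum>i\<in>UNIV. \<Sum>j\<in>UNIV. A $ i $ j * x $ j * y $ i)"
    by (simp add: cdot_def matrix_vector_mult_def sum_distrib_right)
  also have "\<dots> = (\<Sum>j\<in>UNIV. \<Sum>i\<in>UNIV. A $ i $ j * x $ j * y $ i)"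
    by (rule sum.swap)
  also have "\<dots> = cdot x (transpose A *v y)"
    by (simp add: cdot_def matrix_vector_mult_def transpose_def sum_distrib_left mult_ac)
  finally show ?thesis .
qed

lemma bil_congruence: "bil (transpose A ** R ** A) x y = bil R (A *v x) (A *v y)"
  by (simp add: bil_def cdot_matrix matrix_vector_mul_assoc matrix_mul_assoc)

lemma bil_commute: "transpose R = R \<Longrightarrow> bil R x y = bil R y x"
  by (metis bil_def cdot_matrix cdot_commute)

lemma bil_add_right: "bil R x (y + z) = bil R x y + bil R x z"
  by (simp add: bil_def cdot_def matrix_vector_right_distrib distrib_left sum.distrib)

lemma bil_scale_right: "bil R x (c *s y) = c * bil R x y"
  by (simp add: bil_def cdot_def matrix_vector_mult_def sum_distrib_left mult_ac)

lemma bil_add_left: "bil R (x + y) z = bil R x z + bil R y z"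
  by (simp add: bil_def cdot_def distrib_right sum.distrib)

lemma bil_scale_left: "bil R (c *s x) y = c * bil R x y"
  by (simp add: bil_def cdot_def sum_distrib_left mult_ac)

lemma matrix_vector_axis: "A *v axis k 1 = column k A" for A :: "complex^'n^'m"
  by (simp add: vec_eq_iff matrix_vector_mult_def column_def axis_def mult_delta_right cong: if_cong)

lemma bil_axis: "bil R (axis i 1) (axis j 1) = R $ i $ j"
proof -
  have "bil R (axis i 1) (axis j 1) = cdot (axis i 1) (column j R)"
    by (simp only: bil_def matrix_vector_axis)
  also have "\<dots> = R $ i $ j"
    by (simp add: cdot_def column_def axis_def mult_delta_left cong: if_cong)
  finally show ?thesis .
qed

lemma continuous_on_bil: "continuous_on S (\<lambda>x. bil R x x)"
  unfolding bil_def cdot_def matrix_vector_mult_def vec_lambda_beta by (intro continuous_intros)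

lemma hdot_add: "hdot x (y + z) = hdot x y + hdot x z"
  by (simp add: hdot_def distrib_left sum.distrib)

lemma hdot_scale: "hdot x (c *s y) = c * hdot x y"
  by (simp add: hdot_def sum_distrib_left mult_ac)

lemma hdot_commute: "hdot y x = cnj (hdot x y)"
  by (simp add: hdot_def mult.commute)

lemma hdot_self: "hdot x x = complex_of_real ((norm x)\<^sup>2)"
  by (simp add: hdot_def norm_vec_sq complex_norm_square mult.commute flip: of_real_power)

lemma norm_vector_scalar_mult: "norm (c *s x) = cmod c * norm x" for x :: "complex^'n"
proof -
  have "(norm (c *s x))\<^sup>2 = (cmod c * norm x)\<^sup>2"
    by (simp add: norm_vec_sq norm_mult power_mult_distrib sum_distrib_left)
  then show ?thesis by (simp add: power2_eq_iff_nonneg)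
qed

lemma pythagoras:
  assumes "hdot x y = 0"
  shows "(norm (x + t *s y))\<^sup>2 = (norm x)\<^sup>2 + (cmod t)\<^sup>2 * (norm y)\<^sup>2"
proof -
  have "hdot y x = 0" using assms hdot_commute by (metis complex_cnj_zero)
  then have "hdot (t *s y) x = 0" by (metis hdot_commute hdot_scale mult_zero_right complex_cnj_zero)
  moreover have "hdot (x + t *s y) (x + t *s y)
    = cnj (hdot x (x + t *s y)) + cnj (hdot (t *s y) (x + t *s y))"
    by (simp add: hdot_def sum.distrib distrib_right distrib_left mult_ac)
  ultimately have "complex_of_real ((norm (x + t *s y))\<^sup>2)
      = complex_of_real ((norm x)\<^sup>2 + (norm (t *s y))\<^sup>2)"
    using assms by (simp only: hdot_add hdot_scale hdot_self) (simp add: hdot_scale flip: hdot_self)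
  then show ?thesis by (simp only: of_real_eq_iff norm_vector_scalar_mult power_mult_distrib)
qed

text \<open>A maximiser of \<open>|x\<^sup>T R x|\<close> on the unit sphere of a subspace is a Takagi vector: the first-order
  condition makes its Hermitian complement orthogonal to it for the bilinear form as well.\<close>
lemma exists_takagi_vector:
  fixes R :: "complex^'n^'n"
  assumes sym: "transpose R = R"
    and "closed S" and add: "\<And>x y. x \<in> S \<Longrightarrow> y \<in> S \<Longrightarrow> x + y \<in> S"
    and scale: "\<And>c x. x \<in> S \<Longrightarrow> c *s x \<in> S"
    and x0: "x0 \<in> S" "norm x0 = 1"
  obtains x where "x \<in> S" "norm x = 1"
    "\<And>y. y \<in> S \<Longrightarrow> norm y = 1 \<Longrightarrow> cmod (bil R y y) \<le> cmod (bil R x x)"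
    "\<And>y. y \<in> S \<Longrightarrow> hdot x y = 0 \<Longrightarrow> bil R x y = 0"
proof -
  have "compact (S \<inter> sphere 0 1)" using \<open>closed S\<close> by (simp add: closed_Int_compact)
  moreover have "S \<inter> sphere 0 1 \<noteq> {}" using x0 by auto
  ultimately obtain x where x: "x \<in> S \<inter> sphere 0 1"
    "\<And>y. y \<in> S \<inter> sphere 0 1 \<Longrightarrow> cmod (bil R y y) \<le> cmod (bil R x x)"
    using continuous_attains_sup[of "S \<inter> sphere 0 1" "\<lambda>x. cmod (bil R x x)"]
      continuous_on_norm[OF continuous_on_bil] by blast
  have max: "cmod (bil R y y) \<le> cmod (bil R x x)" if "y \<in> S" "norm y = 1" for y
    using x(2) that by simp
  have max': "cmod (bil R y y) \<le> cmod (bil R x x) * (norm y)\<^sup>2" if "y \<in> S" for y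
  proof (cases "y = 0")
    case True
    then show ?thesis by (simp add: bil_def cdot_def)
  next
    case False
    define w where "w = complex_of_real (inverse (norm y)) *s y"
    have "norm w = 1" using False by (simp add: w_def norm_vector_scalar_mult norm_inverse)
    then have "cmod (bil R w w) \<le> cmod (bil R x x)" using max scale that by (simp add: w_def)
    then show ?thesis using False
      by (simp add: w_def bil_scale_left bil_scale_right norm_mult norm_inverse norm_divide field_simps power2_eq_square)
  qed
  have "bil R x y = 0" if "y \<in> S" "hdot x y = 0" for y
  proof (rule quadratic_perturbation_zero)
    fix t
    have "bil R (x + t *s y) (x + t *s y) = bil R x x + 2 * t * bil R x y + t\<^sup>2 * bil R y y"
      using bil_commute[OF sym, of y x]
      by (simp add: bil_add_left bil_add_right bil_scale_left bil_scale_right algebra_simps power2_eq_square)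
    moreover have "(norm (x + t *s y))\<^sup>2 = 1 + (norm y)\<^sup>2 * (cmod t)\<^sup>2"
      using pythagoras[OF that(2)] x by (simp add: mult.commute)
    moreover have "x + t *s y \<in> S" using add scale that x by simp
    ultimately show "cmod (bil R x x + 2 * t * bil R x y + t\<^sup>2 * bil R y y)
        \<le> cmod (bil R x x) * (1 + (norm y)\<^sup>2 * (cmod t)\<^sup>2)"
      using max' by metis
  qed
  then show thesis using that[of x] max x by simp
qed

lemma exists_unit_orthogonal:
  fixes v :: "complex^'n"
  assumes "v \<noteq> 0" "hdot x v = 0"
  obtains w where "norm w = 1" "hdot x w = 0"
  using assms that[of "complex_of_real (inverse (norm v)) *s v"]
  by (simp add: norm_vector_scalar_mult norm_inverse hdot_scale)

lemma exists_orthogonal_unit_vector: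
  fixes x :: "complex^3"
  obtains w :: "complex^3" where "norm w = 1" "hdot x w = 0"
proof (cases "x $ 1 = 0 \<and> x $ 2 = 0")
  case True
  then have "hdot x (axis 1 1) = 0" by (simp add: hdot_def sum_3 axis_def)
  then show thesis using that[of "axis 1 1"] by simp
next
  case False
  define v :: "complex^3" where "v = vector [- cnj (x $ 2), cnj (x $ 1), 0]"
  have "v \<noteq> 0" using False by (auto simp: v_def vec_eq_iff forall_3 vector_3)
  moreover have "hdot x v = 0" by (simp add: v_def hdot_def sum_3 vector_3)
  ultimately show thesis using that exists_unit_orthogonal by blast
qed

text \<open>The conjugated cross product of \<open>x\<close> and \<open>y\<close> is orthogonal to
  both, the inner products being conjugates of determinants with a repeated row. Lagrange's identity
  gives its length.\<close>

lemma exists_third_orthonormal: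
  fixes x y :: "complex^3"
  assumes "norm x = 1" "norm y = 1" "hdot x y = 0"
  obtains w where "norm w = 1" "hdot x w = 0" "hdot y w = 0"
proof -
  define w :: "complex^3" where "w = vector [cnj (x$2 * y$3 - x$3 * y$2),
    cnj (x$3 * y$1 - x$1 * y$3), cnj (x$1 * y$2 - x$2 * y$1)]"
  have "hdot w w = hdot x x * hdot y y - hdot x y * hdot y x"
    by (simp add: hdot_def w_def sum_3 vector_3 algebra_simps)
  then have "complex_of_real ((norm w)\<^sup>2) = 1" using assms by (simp add: hdot_self)
  then have "norm w = 1"
    by (simp only: of_real_eq_1_iff) (use norm_ge_zero[of w] in \<open>auto simp: power2_eq_1_iff\<close>)
  moreover have "hdot x w = 0" "hdot y w = 0"
    by (simp_all add: hdot_def w_def sum_3 vector_3 algebra_simps)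
  ultimately show thesis by (rule that)
qed

text \<open>\<open>x1\<close> maximises the form on the whole unit sphere and \<open>x2\<close> on
  that of the orthogonal complement of \<open>x1\<close>; \<open>x3\<close> completes the basis. The
  Takagi property of \<open>x1\<close> and \<open>x2\<close> kills all off-diagonal entries, and the
  maximality of \<open>x1\<close> bounds every value by \<open>c 1\<close>.\<close>

lemma takagi_factorization:
  fixes R :: "complex^3^3"
  assumes sym: "transpose R = R"
  obtains X :: "complex^3^3" and c where "adj X ** X = mat 1" "transpose X ** R ** X = diag_mat c"
    "\<forall>k. cmod (c k) \<le> cmod (c 1)"
proof -
  have "norm (axis 1 1 :: complex^3) = 1" by simp
  then obtain x1 where x1: "norm x1 = 1"
    "\<And>y. norm y = 1 \<Longrightarrow> cmod (bil R y y) \<le> cmod (bil R x1 x1)"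
    "\<And>y. hdot x1 y = 0 \<Longrightarrow> bil R x1 y = 0"
    using exists_takagi_vector[OF sym, of UNIV "axis 1 1"] by auto
  obtain w where w: "norm w = 1" "hdot x1 w = 0" using exists_orthogonal_unit_vector .
  let ?S = "{y. hdot x1 y = 0}"
  have "closed ?S"
    unfolding hdot_def by (intro closed_Collect_eq continuous_intros)
  then obtain x2 where "x2 \<in> ?S" and x2: "norm x2 = 1"
    and x2': "\<And>y. y \<in> ?S \<Longrightarrow> hdot x2 y = 0 \<Longrightarrow> bil R x2 y = 0"
  proof (rule exists_takagi_vector[OF sym])
    show "w \<in> ?S" using w by simp
  qed (use w in \<open>simp_all add: hdot_add hdot_scale\<close>)
  then have x12: "hdot x1 x2 = 0" by simp
  obtain x3 where x3: "norm x3 = 1" "hdot x1 x3 = 0" "hdot x2 x3 = 0"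
    using exists_third_orthonormal x1(1) x2 x12 by blast
  define X :: "complex^3^3" where "X = transpose (vector [x1, x2, x3])"
  have col: "column 1 X = x1" "column 2 X = x2" "column 3 X = x3"
    by (simp_all add: X_def column_def transpose_def vector_3 vec_eq_iff)
  have "(adj X ** X) $ i $ j = hdot (column i X) (column j X)" for i j
    by (simp add: hdot_def matrix_matrix_mult_def adj_def column_def)
  then have 1: "adj X ** X = mat 1"
    using x1(1) x2 x12 x3 hdot_commute[of x1 x2] hdot_commute[of x1 x3] hdot_commute[of x2 x3]
    by (simp add: vec_eq_iff forall_3 col mat_def hdot_self)
  have ent: "(transpose X ** R ** X) $ i $ j = bil R (column i X) (column j X)" for i j
    by (metis bil_axis bil_congruence matrix_vector_axis)
  define c where "c k = bil R (column k X) (column k X)" for k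
  have 2: "transpose X ** R ** X = diag_mat c"
    using x1(3)[OF x12] x1(3)[OF x3(2)] x2'[of x3] x3(2,3) bil_commute[OF sym, of x2 x1]
      bil_commute[OF sym, of x3 x1] bil_commute[OF sym, of x3 x2]
    by (simp add: vec_eq_iff forall_3 ent col diag_mat_def c_def)
  have "norm (column k X) = 1" for k
    using exhaust_3[of k] x1(1) x2 x3(1) col by auto
  then have "cmod (c k) \<le> cmod (c 1)" for k
    using x1(2) by (simp add: c_def col)
  then show thesis using that[OF 1 2] by blast
qed

section \<open>Sufficiency: decomposing a state into coherent vectors\<close>

definition signed_phases :: "(3 \<Rightarrow> complex) \<Rightarrow> bool \<times> bool \<Rightarrow> complex^3" where
  "signed_phases u = (\<lambda>(s, t). vector [u 1 / 2, (if s then 1 else - 1) * u 2 / 2, (if t then 1 else - 1) * u 3 / 2])"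

text \<open>Over the four sign choices the cross terms of different coordinates cancel, and each
  diagonal entry collects four times 1/4. The sign of the first coordinate stays fixed, as a global
  sign does not change a projector.\<close>

lemma sum_projector_signed_phases:
  assumes "\<And>k. cmod (u k) = 1"
  shows "(\<Sum>p\<in>UNIV. projector (signed_phases u p)) = mat 1"
proof -
  have u: "u k * cnj (u k) = 1" for k
    using assms by (simp flip: complex_norm_square)
  show ?thesis
    unfolding UNIV_Times_UNIV[symmetric] sum.cartesian_product'[symmetric]
    by (simp add: UNIV_bool vec_eq_iff forall_3 signed_phases_def projector_def mat_def vector_3 u)
qed

lemma diag_mat_vector: "(diag_mat c *v x) $ i = c i * x $ i"
  by (simp add: matrix_vector_mult_def diag_mat_def mult_delta_left cong: if_cong)

lemma bil_diag_mat: "bil (diag_mat c) x x = (\<Sum>k\<in>UNIV. c k * (x $ k)\<^sup>2)"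
  by (simp add: bil_def cdot_def diag_mat_vector power2_eq_square mult_ac)

lemma sum_congruence_projector:
  "(\<Sum>i\<in>I. projector (A *v z i)) = A ** (\<Sum>i\<in>I. projector (z i)) ** adj A"
  by (induction I rule: infinite_finite_induct)
     (simp_all add: matrix_add_ldistrib matrix_mult_add_left congruence_projector)

text \<open>The quadratic form vanishing exactly on the spin-coherent vectors, whose two-qubit images
  are the symmetric product vectors; its modulus is the concurrence.\<close>
definition concurrence_form :: "complex^3^3" where
  "concurrence_form = vector [vector [0, 0, - 1], vector [0, 1, 0], vector [- 1, 0, 0]]"

lemma bil_concurrence_form: "bil concurrence_form x x = (x $ 2)\<^sup>2 - 2 * x $ 1 * x $ 3"
  by (simp add: bil_def cdot_def matrix_vector_mult_def concurrence_form_def sum_3 vector_3 power2_eq_square)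

text \<open>AM-GM on the product term. This is what bounds the largest Takagi value by the largest
  eigenvalue of the state.\<close>

lemma cmod_concurrence_le: "cmod (bil concurrence_form x x) \<le> (norm x)\<^sup>2"
proof -
  have "cmod (bil concurrence_form x x) \<le> cmod ((x $ 2)\<^sup>2) + cmod (2 * x $ 1 * x $ 3)"
    unfolding bil_concurrence_form by (rule norm_triangle_ineq4)
  also have "\<dots> \<le> (norm x)\<^sup>2"
    using sum_squares_bound[of "cmod (x $ 1)" "cmod (x $ 3)"]
    by (simp add: norm_vec_sq sum_3 norm_mult norm_power)
  finally show ?thesis .
qed

text \<open>\<open>m\<close> is an upper bound for the eigenvalues of \<open>A ** adj A\<close>,
  whose product is \<open>(cmod (det A))\<^sup>2\<close>. All hypotheses survive multiplication of
  \<open>A\<close> by a unitary matrix from the left, so the conclusion reaches a whole orbit of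
  states.\<close>

lemma separable_if_det_ge:
  fixes A :: "complex^3^3"
  assumes tr: "trace (A ** adj A) = 1"
    and m: "\<And>x. (norm (A *v x))\<^sup>2 \<le> m * (norm x)\<^sup>2"
    and det: "m ^ 3 \<le> 4 * (cmod (det A))\<^sup>2"
  shows "separable (two_qubit (A ** adj A))"
proof -
  let ?R = "transpose A ** concurrence_form ** A"
  have "transpose concurrence_form = concurrence_form"
    by (simp add: vec_eq_iff forall_3 concurrence_form_def transpose_def vector_3)
  then have "transpose ?R = ?R" by (simp add: matrix_transpose_mul matrix_mul_assoc)
  then obtain X :: "complex^3^3" and c where X: "adj X ** X = mat 1" and c: "transpose X ** ?R ** X = diag_mat c"
    and c1: "\<forall>k. cmod (c k) \<le> cmod (c 1)" by (rule takagi_factorization)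
  have XX: "X ** adj X = mat 1" using X matrix_left_right_inverse[of X "adj X"] by simp
  have "cnj (det X) * det X = 1"
    using arg_cong[OF X, of det] by (simp add: det_mul det_adj)
  then have "(cmod (det X))\<^sup>2 = 1"
    by (metis complex_norm_square mult.commute of_real_eq_1_iff of_real_power)
  moreover have "cmod (det concurrence_form) = 1"
    by (simp add: det_3 concurrence_form_def vector_3)
  moreover have "det (diag_mat c) = c 1 * c 2 * c 3"
    by (simp add: det_3 diag_mat_def)
  moreover have "cmod (det (diag_mat c)) = (cmod (det X))\<^sup>2 * (cmod (det A))\<^sup>2 * cmod (det concurrence_form)"
    by (simp add: det_mul det_transpose norm_mult power2_eq_square flip: c)
  \<comment> \<open>Determinants in the Takagi factorization: \<open>X\<close> and
    \<open>concurrence_form\<close> contribute modulus 1, and \<open>A\<close> enters twice.\<close>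
  ultimately have prod: "cmod (c 1) * cmod (c 2) * cmod (c 3) = (cmod (det A))\<^sup>2"
    by (simp add: norm_mult)
  have bil: "bil ?R (X *v a) (X *v a) = (\<Sum>k\<in>UNIV. c k * (a $ k)\<^sup>2)" for a
    by (simp add: c flip: bil_congruence bil_diag_mat)
  have nX: "norm (X *v axis 1 1) = 1"
  proof -
    have "(adj X ** X) $ 1 $ 1 = 1" unfolding X by (simp add: mat_def)
    then have "hdot (column 1 X) (column 1 X) = 1"
      by (simp add: hdot_def matrix_matrix_mult_def adj_def column_def)
    then show ?thesis
      by (simp only: hdot_self of_real_eq_1_iff matrix_vector_axis)
         (use norm_ge_zero[of "column 1 X"] in \<open>auto simp: power2_eq_1_iff\<close>)
  qed
  have "c 1 = bil concurrence_form (A *v (X *v axis 1 1)) (A *v (X *v axis 1 1))"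
    using bil[of "axis 1 1"] by (simp add: bil_congruence sum_3 axis_def)
  then have "cmod (c 1) \<le> (norm (A *v (X *v axis 1 1)))\<^sup>2"
    using cmod_concurrence_le by simp
  also have "\<dots> \<le> m" using m[of "X *v axis 1 1"] nX by simp
  finally have c1m: "cmod (c 1) \<le> m" .
  have triangle: "cmod (c 1) \<le> cmod (c 2) + cmod (c 3)"
  proof (cases "c 1 = 0")
    case False
    \<comment> \<open>Since \<open>cmod (c 1)\<close> is at most \<open>m\<close>, the product
      formula turns the determinant hypothesis into a cubic inequality, from which one factor
      \<open>cmod (c 1)\<close> cancels; AM-GM does the rest.\<close>
    have "cmod (c 1) ^ 3 \<le> m ^ 3" using c1m by (simp add: power_mono)
    then have "cmod (c 1) * (cmod (c 1))\<^sup>2 \<le> cmod (c 1) * (4 * cmod (c 2) * cmod (c 3))"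
      using det prod by (simp add: power2_eq_square power3_eq_cube mult_ac)
    then have "(cmod (c 1))\<^sup>2 \<le> 4 * cmod (c 2) * cmod (c 3)"
      using False by simp
    also have "\<dots> \<le> (cmod (c 2) + cmod (c 3))\<^sup>2"
      using sum_squares_bound[of "cmod (c 2)" "cmod (c 3)"] by (simp add: power2_sum)
    finally show ?thesis by (rule power2_le_imp_le) simp
  qed simp
  obtain u1 u2 u3 where u: "cmod u1 = 1" "cmod u2 = 1" "cmod u3 = 1"
    "u1\<^sup>2 * c 1 + u2\<^sup>2 * c 2 + u3\<^sup>2 * c 3 = 0"
    using triangle_phases[OF triangle c1[rule_format] c1[rule_format]] .
  define u where "u k = (if k = 1 then u1 else if k = 2 then u2 else u3)" for k :: 3
  define z where "z p = A *v (X *v signed_phases u p)" for p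
  \<comment> \<open>The signs disappear on squaring, so all four vectors share the value zero
    enforced by the choice of phases.\<close>
  have sgn: "(\<Sum>k\<in>UNIV. c k * (signed_phases u p $ k)\<^sup>2) = 0" for p
  proof -
    have "(\<Sum>k\<in>UNIV. c k * (signed_phases u p $ k)\<^sup>2)
      = (u1\<^sup>2 * c 1 + u2\<^sup>2 * c 2 + u3\<^sup>2 * c 3) / 4"
      by (simp add: signed_phases_def sum_3 vector_3 u_def power_divide power_mult_distrib split: prod.split)
    then show ?thesis using u(4) by simp
  qed
  have "bil concurrence_form (z p) (z p) = 0" for p
    using bil[of "signed_phases u p"] sgn by (simp add: z_def bil_congruence)
  then have q: "(z p $ 2)\<^sup>2 = 2 * z p $ 1 * z p $ 3" for p
    by (simp add: bil_concurrence_form)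
  have "(\<Sum>p\<in>UNIV. projector (z p)) = A ** (X ** mat 1 ** adj X) ** adj A"
    unfolding z_def sum_congruence_projector
    by (subst sum_projector_signed_phases) (use u in \<open>simp_all add: u_def\<close>)
  then have "(\<Sum>p\<in>UNIV. projector (z p)) = A ** adj A"
    by (simp add: XX)
  then show ?thesis
    using separable_sum_projector[of UNIV z] q tr by simp
qed

section \<open>Necessity: positivity under partial transposition\<close>

text \<open>The bound is the quadratic form of the partial transpose of \<open>\<sigma>\<close> at
  \<open>x |+\<rangle>|+\<rangle> + y |-\<rangle>|-\<rangle>\<close>.\<close>
lemma separable_partial_transpose:
  assumes "separable \<sigma>"
  shows "0 \<le> x\<^sup>2 * Re (\<sigma> $ (1, 1) $ (1, 1)) + y\<^sup>2 * Re (\<sigma> $ (2, 2) $ (2, 2))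
    + 2 * x * y * Re (\<sigma> $ (1, 2) $ (2, 1))" (is "0 \<le> ?f \<sigma>")
proof -
  have "0 \<le> ?f (projector (tensor \<phi> \<psi>))" for \<phi> \<psi>
  proof -
    let ?a = "cmod (\<phi> $ 1)" and ?b = "cmod (\<phi> $ 2)" and ?c = "cmod (\<psi> $ 1)" and ?d = "cmod (\<psi> $ 2)"
    let ?w = "\<phi> $ 1 * \<psi> $ 2 * (cnj (\<phi> $ 2) * cnj (\<psi> $ 1))"
    have "\<bar>2 * x * y * Re ?w\<bar> \<le> 2 * \<bar>x\<bar> * \<bar>y\<bar> * cmod ?w"
      unfolding abs_mult by (intro mult_mono abs_Re_le_cmod) auto
    \<comment> \<open>The regrouping of moduli is decisive: the off-diagonal entry joins the
      amplitudes of |+>|-> and |->|+>, but its modulus is also the product of those of |+>|+> and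
      |->|->, whose squares are the two diagonal entries.\<close>
    also have "\<dots> = 2 * (\<bar>x\<bar> * ?a * ?c) * (\<bar>y\<bar> * ?b * ?d)"
      by (simp add: norm_mult)
    also have "\<dots> \<le> (\<bar>x\<bar> * ?a * ?c)\<^sup>2 + (\<bar>y\<bar> * ?b * ?d)\<^sup>2"
      by (rule sum_squares_bound)
    finally have "0 \<le> x\<^sup>2 * (?a * ?c)\<^sup>2 + y\<^sup>2 * (?b * ?d)\<^sup>2 + 2 * x * y * Re ?w"
      by (simp add: power_mult_distrib abs_le_iff)
    moreover have "Re (v * w * (cnj v * cnj w)) = (cmod v * cmod w)\<^sup>2" for v w
      by (metis Re_complex_of_real complex_cnj_mult complex_norm_square norm_mult of_real_power)
    ultimately show ?thesis by (simp add: projector_def tensor_def)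
  qed
  then have "{projector (tensor \<phi> \<psi>) | \<phi> \<psi>. norm \<phi> = 1 \<and> norm \<psi> = 1} \<subseteq> {\<sigma>. 0 \<le> ?f \<sigma>}"
    by blast
  moreover have "convex {\<sigma>. 0 \<le> ?f \<sigma>}"
  proof (rule convexI)
    fix \<sigma> \<tau> :: "complex^(2\<times>2)^(2\<times>2)" and u v :: real
    assume *: "\<sigma> \<in> {\<sigma>. 0 \<le> ?f \<sigma>}" "\<tau> \<in> {\<sigma>. 0 \<le> ?f \<sigma>}" "0 \<le> u" "0 \<le> v"
    have "?f (u *\<^sub>R \<sigma> + v *\<^sub>R \<tau>) = u * ?f \<sigma> + v * ?f \<tau>"
      by (simp add: algebra_simps)
    also have "\<dots> \<ge> 0" using * by simp
    finally show "u *\<^sub>R \<sigma> + v *\<^sub>R \<tau> \<in> {\<sigma>. 0 \<le> ?f \<sigma>}" by simp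
  qed
  ultimately show ?thesis
    using assms hull_minimal unfolding separable_def by blast
qed

lemma separable_diag_imp:
  assumes "separable (two_qubit (diag_mat (\<lambda>k. complex_of_real (l k))))"
    and "\<And>k. 0 < l k"
  shows "(l 2)\<^sup>2 \<le> 4 * l 1 * l 3"
proof -
  let ?\<sigma> = "two_qubit (diag_mat (\<lambda>k. complex_of_real (l k)))"
  have "?\<sigma> = sym_isometry ** (diag_mat (\<lambda>k. complex_of_real (l k)) ** adj sym_isometry)"
    by (simp add: two_qubit_def matrix_mul_assoc)
  moreover have "complex_of_real (sqrt 2) * complex_of_real (sqrt 2) = 2"
    by (metis abs_numeral of_real_mult of_real_numeral real_sqrt_mult_self)
  ultimately have \<sigma>: "?\<sigma> $ (1, 1) $ (1, 1) = l 1" "?\<sigma> $ (2, 2) $ (2, 2) = l 3"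
    "?\<sigma> $ (1, 2) $ (2, 1) = l 2 / 2"
    by (simp_all add: matrix_matrix_mult_def sym_isometry_def adj_def transpose_def tensor_def
        diag_mat_def sum_3 vector_3 ket_plus_def ket_minus_def axis_def
        scaleR_conv_of_real[where 'a=complex] field_simps)
  \<comment> \<open>These weights make both diagonal terms equal to \<open>l 1 * l 3\<close> and the
    cross term negative. After cancelling \<open>sqrt (l 1) * sqrt (l 3)\<close> and squaring, what
    remains is nonnegativity of the determinant of the 2 by 2 block.\<close>
  have "0 \<le> (sqrt (l 3))\<^sup>2 * l 1 + (- sqrt (l 1))\<^sup>2 * l 3 + 2 * sqrt (l 3) * (- sqrt (l 1)) * (l 2 / 2)"
    using separable_partial_transpose[OF assms(1), of "sqrt (l 3)" "- sqrt (l 1)"]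
    by (simp only: \<sigma> Re_complex_of_real)
  then have "l 2 * (sqrt (l 1) * sqrt (l 3)) \<le> 2 * l 1 * l 3"
    using assms(2)[of 1] assms(2)[of 3] by (simp add: mult_ac)
  also have "\<dots> = 2 * (sqrt (l 1) * sqrt (l 3)) * (sqrt (l 1) * sqrt (l 3))"
    using assms(2)[of 1] assms(2)[of 3] by (simp add: mult_ac)
  finally have "l 2 \<le> 2 * (sqrt (l 1) * sqrt (l 3))"
    using assms(2)[of 1] assms(2)[of 3] by (simp add: mult_le_cancel_right)
  then have "(l 2)\<^sup>2 \<le> (2 * (sqrt (l 1) * sqrt (l 3)))\<^sup>2"
    using assms(2)[of 2] by (intro power_mono) auto
  then show ?thesis
    using assms(2)[of 1] assms(2)[of 3] by (simp add: power_mult_distrib)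
qed

section \<open>Matrix exponential and thermal state of a diagonalised Hamiltonian\<close>

lemma congruence_diag_mat_mult:
  assumes "adj V ** V = mat 1"
  shows "(V ** diag_mat d ** adj V) ** (V ** diag_mat e ** adj V) = V ** diag_mat (\<lambda>k. d k * e k) ** adj V"
proof -
  have "(V ** diag_mat d ** adj V) ** (V ** diag_mat e ** adj V)
    = V ** diag_mat d ** (adj V ** V) ** diag_mat e ** adj V"
    by (simp only: matrix_mul_assoc)
  also have "\<dots> = V ** (diag_mat d ** diag_mat e) ** adj V"
    by (simp add: assms matrix_mul_assoc)
  finally show ?thesis by (simp add: diag_mat_mult)
qed

lemma mat_power_diag:
  assumes "adj V ** V = mat 1" "V ** adj V = mat 1"
  shows "mat_power (V ** diag_mat d ** adj V) n = V ** diag_mat (\<lambda>k. d k ^ n) ** adj V"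
proof (induction n)
  case 0
  have "diag_mat (\<lambda>k. 1) = (mat 1 :: complex^'a^'a)" by (simp add: diag_mat_def mat_def)
  then show ?case by (simp add: assms)
qed (simp add: congruence_diag_mat_mult assms)

text \<open>Each entry of the power series is a finite linear combination of scalar exponential
  series in the \<open>d k\<close>, so convergence can be checked entrywise.\<close>

lemma mat_exp_diag:
  assumes "adj V ** V = mat 1" "V ** adj V = mat 1"
  shows "mat_exp (V ** diag_mat d ** adj V) = V ** diag_mat (\<lambda>k. exp (d k)) ** adj V"
proof -
  have "(\<lambda>n. ((1 / fact n) *\<^sub>R (V ** diag_mat (\<lambda>k. d k ^ n) ** adj V)) $ i $ j)
      sums (V ** diag_mat (\<lambda>k. exp (d k)) ** adj V) $ i $ j" for i j
  proof -
    have "(\<lambda>n. d k ^ n /\<^sub>R fact n * (V $ i $ k * cnj (V $ j $ k)))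
        sums (exp (d k) * (V $ i $ k * cnj (V $ j $ k)))" for k
      by (intro sums_mult2 exp_converges)
    then have "(\<lambda>n. \<Sum>k\<in>UNIV. d k ^ n /\<^sub>R fact n * (V $ i $ k * cnj (V $ j $ k)))
        sums (\<Sum>k\<in>UNIV. exp (d k) * (V $ i $ k * cnj (V $ j $ k)))"
      by (intro sums_sum)
    then show ?thesis
      by (simp add: diag_mat_conj_entry scaleR_sum_right inverse_eq_divide)
  qed
  then have "(\<lambda>n. (1 / fact n) *\<^sub>R (V ** diag_mat (\<lambda>k. d k ^ n) ** adj V))
      sums (V ** diag_mat (\<lambda>k. exp (d k)) ** adj V)"
    unfolding sums_def by (intro vec_tendstoI) (simp add: sum_component)
  then show ?thesis
    by (simp add: mat_exp_def mat_power_diag[OF assms] sums_iff)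
qed

lemma trace_congruence:
  assumes "adj V ** V = mat 1"
  shows "trace (V ** diag_mat d ** adj V) = (\<Sum>k\<in>UNIV. d k)"
proof -
  have "trace (V ** diag_mat d ** adj V) = trace (adj V ** (V ** diag_mat d))"
    by (rule trace_mul_sym)
  also have "\<dots> = trace (diag_mat d)" by (simp add: matrix_mul_assoc assms)
  finally show ?thesis by (simp add: trace_def diag_mat_def)
qed

lemma thermal_state_diag:
  assumes V: "adj V ** V = mat 1" "V ** adj V = mat 1"
    and l: "\<And>k. l k = exp (- h k / (kB * T)) / (\<Sum>j\<in>UNIV. exp (- h j / (kB * T)))"
  shows "thermal_state (V ** diag_mat (\<lambda>k. complex_of_real (h k)) ** adj V) kB T
    = V ** diag_mat (\<lambda>k. complex_of_real (l k)) ** adj V"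
proof -
  let ?E = "V ** diag_mat (\<lambda>k. complex_of_real (exp (- h k / (kB * T)))) ** adj V"
  have "(- 1 / (kB * T)) *\<^sub>R (V ** diag_mat (\<lambda>k. complex_of_real (h k)) ** adj V)
      = V ** diag_mat (\<lambda>k. complex_of_real (- h k / (kB * T))) ** adj V"
    by (simp add: vec_eq_iff diag_mat_conj_entry scaleR_sum_right scaleR_conv_of_real[where 'a=complex] mult.assoc
        sum_negf sum_divide_distrib)
  then have E: "mat_exp ((- 1 / (kB * T)) *\<^sub>R (V ** diag_mat (\<lambda>k. complex_of_real (h k)) ** adj V)) = ?E"
    by (simp only: mat_exp_diag[OF V] exp_of_real)
  have tr: "trace ?E = complex_of_real (\<Sum>j\<in>UNIV. exp (- h j / (kB * T)))"
    by (simp only: trace_congruence[OF V(1)] of_real_sum)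
  show ?thesis
    unfolding thermal_state_def E Let_def tr
    by (simp add: vec_eq_iff diag_mat_conj_entry l sum_divide_distrib)
qed

section \<open>Absolute separability in terms of eigenvalues\<close>

lemma hdot_matrix: "hdot (A *v x) y = hdot x (adj A *v y)"
proof -
  have "hdot (A *v x) y = (\<Sum>i\<in>UNIV. \<Sum>j\<in>UNIV. cnj (A $ i $ j) * cnj (x $ j) * y $ i)"
    by (simp add: hdot_def matrix_vector_mult_def sum_distrib_right)
  also have "\<dots> = (\<Sum>j\<in>UNIV. \<Sum>i\<in>UNIV. cnj (A $ i $ j) * cnj (x $ j) * y $ i)"
    by (rule sum.swap)
  also have "\<dots> = hdot x (adj A *v y)"
    by (simp add: hdot_def matrix_vector_mult_def adj_def sum_distrib_left mult_ac)
  finally show ?thesis .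
qed

lemma norm_isometry:
  assumes "adj U ** U = mat 1"
  shows "norm (U *v x) = norm x"
proof -
  have "hdot (U *v x) (U *v x) = hdot x x"
    by (simp add: hdot_matrix matrix_vector_mul_assoc assms)
  then have "(norm (U *v x))\<^sup>2 = (norm x)\<^sup>2" by (simp only: hdot_self of_real_eq_iff)
  then show ?thesis by (simp add: power2_eq_iff_nonneg)
qed

lemma cmod_det_unitary:
  fixes U :: "complex^3^3"
  assumes "U ** adj U = mat 1"
  shows "cmod (det U) = 1"
proof -
  have "det U * cnj (det U) = 1"
    using arg_cong[OF assms, of det] by (simp add: det_mul det_adj)
  then have "(cmod (det U))\<^sup>2 = 1"
    by (metis complex_norm_square of_real_eq_1_iff of_real_power)
  then show ?thesis using norm_ge_zero[of "det U"] by (auto simp: power2_eq_1_iff simp del: norm_ge_zero)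
qed

text \<open>Supplies the factor, a square root of the state up to a unitary, to which
  \<open>separable_if_det_ge\<close> applies.\<close>

lemma diag_mat_sqrt_factor:
  assumes "\<And>k. 0 \<le> l k"
  shows "V ** diag_mat (\<lambda>k. complex_of_real (l k)) ** adj V
    = (V ** diag_mat (\<lambda>k. complex_of_real (sqrt (l k)))) ** adj (V ** diag_mat (\<lambda>k. complex_of_real (sqrt (l k))))"
proof -
  have "adj (diag_mat (\<lambda>k. complex_of_real (sqrt (l k)))) = diag_mat (\<lambda>k. complex_of_real (sqrt (l k)))"
    by (simp add: vec_eq_iff adj_def diag_mat_def)
  moreover have "diag_mat (\<lambda>k. complex_of_real (sqrt (l k))) ** diag_mat (\<lambda>k. complex_of_real (sqrt (l k)))
      = diag_mat (\<lambda>k. complex_of_real (l k))"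
    using assms by (simp add: diag_mat_mult flip: of_real_mult)
  ultimately show ?thesis
    by (metis adj_mult matrix_mul_assoc)
qed

lemma density_operator_mult_adj:
  assumes "trace (B ** adj B) = 1"
  shows "density_operator (B ** adj B)"
proof -
  have "0 \<le> Re (\<Sum>i\<in>UNIV. cnj (v $ i) * ((B ** adj B) *v v) $ i)" for v
  proof -
    have "(\<Sum>i\<in>UNIV. cnj (v $ i) * ((B ** adj B) *v v) $ i) = hdot (adj B *v v) (adj B *v v)"
      by (simp add: hdot_matrix hdot_def[symmetric] matrix_vector_mul_assoc)
    then show ?thesis by (simp only: hdot_self Re_complex_of_real) simp
  qed
  then show ?thesis using assms by (simp add: density_operator_def adj_mult)
qed

text \<open>A rotation by \<open>U\<close> only replaces \<open>V\<close> by \<open>U ** V\<close>,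
  so every rotated state has the same eigenvalues and meets the same bounds on norm and
  determinant.\<close>

lemma sym_abs_separable_if:
  fixes V :: "complex^3^3"
  assumes V: "adj V ** V = mat 1" "V ** adj V = mat 1"
    and l: "\<And>k. 0 < l k" "(\<Sum>k\<in>UNIV. l k) = 1"
    and c: "\<And>k. l k ^ 3 \<le> 4 * (l 1 * l 2 * l 3)"
  shows "sym_abs_separable (V ** diag_mat (\<lambda>k. complex_of_real (l k)) ** adj V)" (is "sym_abs_separable ?\<rho>")
proof -
  let ?S = "diag_mat (\<lambda>k. complex_of_real (sqrt (l k)))"
  have l0: "0 \<le> l k" for k using l(1)[of k] by simp
  have tr: "trace (W ** diag_mat (\<lambda>k. complex_of_real (l k)) ** adj W) = 1" if "adj W ** W = mat 1" for W :: "complex^3^3"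
    using l(2) by (simp add: trace_congruence[OF that] flip: of_real_sum)
  have "density_operator ?\<rho>"
    using tr[OF V(1)] by (simp add: diag_mat_sqrt_factor l0 density_operator_mult_adj)
  moreover have "separable (two_qubit (U ** ?\<rho> ** adj U))" if "U \<in> SU" for U
  proof -
    let ?W = "U ** V"
    have "adj ?W ** ?W = adj V ** (adj U ** U) ** V" "?W ** adj ?W = U ** (V ** adj V) ** adj U"
      by (simp_all only: adj_mult matrix_mul_assoc)
    then have W: "adj ?W ** ?W = mat 1" "?W ** adj ?W = mat 1"
      using that V by (simp_all add: SU_def)
    have *: "U ** ?\<rho> ** adj U = (?W ** ?S) ** adj (?W ** ?S)"
    proof -
      have "U ** ?\<rho> ** adj U = ?W ** diag_mat (\<lambda>k. complex_of_real (l k)) ** adj ?W"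
        by (simp add: adj_mult matrix_mul_assoc)
      then show ?thesis by (simp only: diag_mat_sqrt_factor l0)
    qed
    \<comment> \<open>The largest eigenvalue bounds the squared operator norm of
      \<open>?W ** ?S\<close>; being attained, it inherits the cubic bound.\<close>
    define m where "m = Max (range l)"
    have lm: "l k \<le> m" for k by (simp add: m_def)
    have "m \<in> range l" unfolding m_def by (rule Max_in) auto
    then have m3: "m ^ 3 \<le> 4 * (l 1 * l 2 * l 3)" using c by auto
    have "(norm ((?W ** ?S) *v x))\<^sup>2 \<le> m * (norm x)\<^sup>2" for x
    proof -
      have "norm ((?W ** ?S) *v x) = norm (?S *v x)"
        by (metis W(1) norm_isometry matrix_vector_mul_assoc)
      then have "(norm ((?W ** ?S) *v x))\<^sup>2 = (\<Sum>k\<in>UNIV. l k * (cmod (x $ k))\<^sup>2)"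
        using l0 by (simp add: norm_vec_sq diag_mat_vector norm_mult power_mult_distrib)
      also have "\<dots> \<le> (\<Sum>k\<in>UNIV. m * (cmod (x $ k))\<^sup>2)"
        by (intro sum_mono mult_right_mono lm) simp
      finally show ?thesis by (simp add: norm_vec_sq sum_distrib_left)
    qed
    moreover have "(cmod (det (?W ** ?S)))\<^sup>2 = l 1 * l 2 * l 3"
    proof -
      have "det ?S = complex_of_real (sqrt (l 1)) * complex_of_real (sqrt (l 2)) * complex_of_real (sqrt (l 3))"
        by (simp add: det_3 diag_mat_def)
      then show ?thesis
        using cmod_det_unitary[OF W(2)] l0 by (simp only: det_mul norm_mult power_mult_distrib) simp
    qed
    moreover have "trace ((?W ** ?S) ** adj (?W ** ?S)) = 1"
      using tr[OF W(1)] by (simp only: diag_mat_sqrt_factor l0)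
    ultimately show ?thesis
      unfolding * using m3 by (intro separable_if_det_ge[where m = m]) simp_all
  qed
  ultimately show ?thesis by (simp add: sym_abs_separable_def)
qed

lemma mat_mult_entry: "(mat c ** M) $ i $ j = c * M $ i $ j" "(M ** mat c) $ i $ j = M $ i $ j * c"
  by (simp_all add: matrix_matrix_mult_def mat_def mult_delta_left mult_delta_right cong: if_cong)

text \<open>A global phase cancels under conjugation, so SU(3) moves a state wherever the full
  unitary group does. The phase is a cube root of the inverse of \<open>det M\<close>, as
  \<open>mat c\<close> has determinant \<open>c ^ 3\<close>.\<close>

lemma unitary_phase_SU:
  fixes M :: "complex^3^3"
  assumes "M ** adj M = mat 1" "adj M ** M = mat 1"
  obtains c where "cmod c = 1" "mat c ** M \<in> SU"
proof -
  define c where "c = cis (- Arg (det M) / 3)"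
  have "det M = cis (Arg (det M))"
    using rcis_cmod_Arg[of "det M"] cmod_det_unitary[OF assms(1)] by (simp add: rcis_def)
  moreover have "c ^ 3 = cis (- Arg (det M))"
    unfolding c_def Complex.DeMoivre by (rule arg_cong[where f = cis]) simp
  ultimately have "c ^ 3 * det M = 1" by (metis add.left_inverse cis_mult cis_zero)
  moreover have "det (mat c :: complex^3^3) = c ^ 3" by (simp add: det_3 mat_def power3_eq_cube)
  ultimately have d: "det (mat c ** M) = 1" by (simp add: det_mul)
  have "c * cnj c = 1" by (simp add: c_def flip: complex_norm_square)
  then have c: "mat c ** mat (cnj c) = (mat 1 :: complex^3^3)"
    by (simp add: vec_eq_iff mat_mult_entry) (simp add: mat_def)
  have "adj (mat c ** M) = adj M ** mat (cnj c)"
    by (simp add: vec_eq_iff adj_def mat_mult_entry mult.commute)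
  then have "(mat c ** M) ** adj (mat c ** M) = mat c ** (M ** adj M) ** mat (cnj c)"
    by (simp only: matrix_mul_assoc)
  then have "(mat c ** M) ** adj (mat c ** M) = mat 1" by (simp add: assms c)
  moreover from this have "adj (mat c ** M) ** (mat c ** M) = mat 1"
    by (metis matrix_left_right_inverse)
  ultimately have "mat c ** M \<in> SU" using d by (simp add: SU_def)
  moreover have "cmod c = 1" by (simp add: c_def)
  ultimately show thesis using that by blast
qed

lemma sym_abs_separable_imp:
  fixes V :: "complex^3^3"
  assumes V: "adj V ** V = mat 1" "V ** adj V = mat 1"
    and l: "\<And>k. 0 < l k"
    and sas: "sym_abs_separable (V ** diag_mat (\<lambda>k. complex_of_real (l k)) ** adj V)" (is "sym_abs_separable ?\<rho>")
  shows "l k ^ 3 \<le> 4 * (l 1 * l 2 * l 3)"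
proof -
  \<comment> \<open>The transposition of \<open>2\<close> and \<open>k\<close> puts the eigenvalue
    \<open>l k\<close> into the middle slot, the one that \<open>separable_diag_imp\<close>
    bounds.\<close>
  define \<pi> :: "3 \<Rightarrow> 3" where "\<pi> i = (if i = 2 then k else if i = k then 2 else i)" for i
  have \<pi>: "\<pi> i = \<pi> j \<longleftrightarrow> i = j" for i j by (auto simp: \<pi>_def)
  define P :: "complex^3^3" where "P = (\<chi> i j. if j = \<pi> i then 1 else 0)"
  have PD: "P ** diag_mat d ** adj P = diag_mat (\<lambda>i. d (\<pi> i))" for d
    unfolding vec_eq_iff diag_mat_conj_entry
    by (simp add: P_def \<pi> diag_mat_def mult_delta_left mult_delta_right if_distrib[of cnj] cong: if_cong)
  have "diag_mat (\<lambda>k. 1) = (mat 1 :: complex^3^3)" by (simp add: diag_mat_def mat_def)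
  with PD[of "\<lambda>k. 1"] have P: "P ** adj P = mat 1" by simp
  then have P': "adj P ** P = mat 1" by (metis matrix_left_right_inverse)
  let ?M = "P ** adj V"
  have "?M ** adj ?M = P ** (adj V ** V) ** adj P" "adj ?M ** ?M = V ** (adj P ** P) ** adj V"
    by (simp_all only: adj_mult adj_adj matrix_mul_assoc)
  then have "?M ** adj ?M = mat 1" "adj ?M ** ?M = mat 1"
    using V P P' by simp_all
  then obtain c where c: "cmod c = 1" "mat c ** ?M \<in> SU" using unitary_phase_SU by blast
  have cc: "c * cnj c = 1" using c(1) by (simp flip: complex_norm_square)
  have "?M ** ?\<rho> ** adj ?M = P ** (adj V ** V) ** diag_mat (\<lambda>k. complex_of_real (l k)) ** (adj V ** V) ** adj P"
    by (simp only: adj_mult adj_adj matrix_mul_assoc)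
  then have *: "?M ** ?\<rho> ** adj ?M = diag_mat (\<lambda>i. complex_of_real (l (\<pi> i)))"
    by (simp add: V PD)
  have "adj (mat c ** ?M) = adj ?M ** mat (cnj c)"
    by (simp add: vec_eq_iff adj_def mat_mult_entry mult.commute)
  then have "(mat c ** ?M) ** ?\<rho> ** adj (mat c ** ?M) = mat c ** (?M ** ?\<rho> ** adj ?M) ** mat (cnj c)"
    by (simp only: matrix_mul_assoc)
  also have "\<dots> = diag_mat (\<lambda>i. complex_of_real (l (\<pi> i)))"
    unfolding * using cc by (simp add: vec_eq_iff mat_mult_entry mult.commute mult.left_commute)
  finally have "separable (two_qubit (diag_mat (\<lambda>i. complex_of_real (l (\<pi> i)))))"
    using sas c(2) unfolding sym_abs_separable_def by metis
  then have "(l (\<pi> 2))\<^sup>2 \<le> 4 * l (\<pi> 1) * l (\<pi> 3)"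
    using l by (rule separable_diag_imp)
  \<comment> \<open>The factor \<open>l k\<close> completes the right side to the product of all
    three eigenvalues, which does not depend on the permutation.\<close>
  then have "l k * (l k)\<^sup>2 \<le> l k * (4 * l (\<pi> 1) * l (\<pi> 3))"
    using l[of k] by (simp add: \<pi>_def)
  then show ?thesis
    using exhaust_3[of k] by (auto simp: \<pi>_def power2_eq_square power3_eq_cube mult_ac)
qed

text \<open>Both sides of the cubic inequality are homogeneous of degree 3 in the eigenvalues, so
  the partition function \<open>Z\<close> cancels. With 4 written as an exponential, comparing
  exponents leaves a linear inequality in the energies.\<close>

lemma sym_abs_separable_thermal_iff:
  fixes V :: "complex^3^3"
  assumes V: "adj V ** V = mat 1" "V ** adj V = mat 1" and "kB > 0" "T > 0"
  shows "sym_abs_separable (thermal_state (V ** diag_mat (\<lambda>k. complex_of_real (h k)) ** adj V) kB T)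
    \<longleftrightarrow> (\<forall>k. 3 * h k - (h 1 + h 2 + h 3) + 2 * kB * T * ln 2 \<ge> 0)"
proof -
  define Z where "Z = (\<Sum>j\<in>UNIV. exp (- h j / (kB * T)))"
  define l where "l k = exp (- h k / (kB * T)) / Z" for k
  have Z: "Z > 0" by (simp add: Z_def sum_pos)
  have l: "0 < l k" for k using Z by (simp add: l_def)
  have sum: "(\<Sum>k\<in>UNIV. l k) = 1"
    using Z unfolding l_def sum_divide_distrib[symmetric] Z_def[symmetric] by simp
  have "l k ^ 3 \<le> 4 * (l 1 * l 2 * l 3) \<longleftrightarrow> 3 * h k - (h 1 + h 2 + h 3) + 2 * kB * T * ln 2 \<ge> 0" for k
  proof -
    have pow: "exp x ^ 3 = exp (3 * x)" for x :: real
      by (simp flip: exp_of_nat_mult)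
    have four: "4 = exp (2 * ln 2 :: real)"
      by (simp add: exp_double power2_eq_square)
    have "l k ^ 3 \<le> 4 * (l 1 * l 2 * l 3) \<longleftrightarrow>
      exp (- h k / (kB * T)) ^ 3 \<le> 4 * (exp (- h 1 / (kB * T)) * exp (- h 2 / (kB * T)) * exp (- h 3 / (kB * T)))"
      using Z by (simp add: l_def power_divide power3_eq_cube field_simps)
    also have "\<dots> \<longleftrightarrow> 3 * (- h k / (kB * T)) \<le> 2 * ln 2 + (- h 1 / (kB * T) + - h 2 / (kB * T) + - h 3 / (kB * T))"
      by (simp only: pow four exp_add[symmetric] exp_le_cancel_iff)
    also have "\<dots> \<longleftrightarrow> 3 * h k - (h 1 + h 2 + h 3) + 2 * kB * T * ln 2 \<ge> 0"
    proof -
      define K where "K = kB * T"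
      have "K > 0" using assms(3,4) by (simp add: K_def)
      then have "3 * h k - (h 1 + h 2 + h 3) + 2 * K * ln 2
          = K * (2 * ln 2 + (- h 1 / K + - h 2 / K + - h 3 / K) - 3 * (- h k / K))"
        by (simp add: field_simps)
      then have "3 * (- h k / K) \<le> 2 * ln 2 + (- h 1 / K + - h 2 / K + - h 3 / K)
          \<longleftrightarrow> 3 * h k - (h 1 + h 2 + h 3) + 2 * K * ln 2 \<ge> 0"
        using \<open>K > 0\<close> by (simp only: zero_le_mult_iff) (simp, linarith)
      then show ?thesis by (simp add: K_def mult.assoc)
    qed
    finally show ?thesis .
  qed
  moreover have "thermal_state (V ** diag_mat (\<lambda>k. complex_of_real (h k)) ** adj V) kB T
    = V ** diag_mat (\<lambda>k. complex_of_real (l k)) ** adj V"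
    using V by (rule thermal_state_diag) (simp add: l_def Z_def)
  ultimately show ?thesis
    using sym_abs_separable_if[OF V l sum] sym_abs_separable_imp[where l = l, OF V l] by metis
qed

section \<open>Spectrum of the Hamiltonian\<close>

lemma hamiltonian_diagonalization:
  fixes hbar g \<gamma>x \<gamma>z :: real
  defines "s \<equiv> sqrt (4 * g\<^sup>2 + \<gamma>x\<^sup>2)"
  defines "h \<equiv> \<lambda>k::3. hbar * (if k = 1 then \<gamma>z + \<gamma>x / 2 + s / 2 else if k = 2 then \<gamma>x else \<gamma>z + \<gamma>x / 2 - s / 2)"
  obtains V :: "complex^3^3" where "adj V ** V = mat 1" "V ** adj V = mat 1"
    "hamiltonian hbar g \<gamma>x \<gamma>z = V ** diag_mat (\<lambda>k. complex_of_real (h k)) ** adj V"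
proof -
  \<comment> \<open>The middle basis vector decouples with energy \<open>hbar * \<gamma>x\<close>.
    Up to the factor \<open>hbar\<close>, the outer 2 by 2 block is a multiple of the identity plus
    the symmetric matrix with rows \<open>g, \<gamma>x / 2\<close> and
    \<open>\<gamma>x / 2, - g\<close>. A rotation by half the argument of \<open>z\<close>
    diagonalises the latter, with eigenvalues plus and minus \<open>cmod z\<close>.\<close>
  define z where "z = Complex g (\<gamma>x / 2)"
  define \<theta> where "\<theta> = Arg z / 2"
  have cz: "cmod z = s / 2"
  proof -
    have "g\<^sup>2 + (\<gamma>x / 2)\<^sup>2 = (4 * g\<^sup>2 + \<gamma>x\<^sup>2) / 4" by (simp add: power_divide)
    then show ?thesis by (simp only: z_def s_def cmod_def complex.sel real_sqrt_divide) simp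
  qed
  have "z = rcis (s / 2) (2 * \<theta>)" using rcis_cmod_Arg[of z] by (simp add: cz \<theta>_def)
  then have "g = s / 2 * cos (2 * \<theta>)" "\<gamma>x / 2 = s / 2 * sin (2 * \<theta>)"
    by (metis Re_rcis z_def complex.sel(1), metis Im_rcis z_def complex.sel(2))
  then have g: "g = s / 2 * ((cos \<theta>)\<^sup>2 - (sin \<theta>)\<^sup>2)" and x: "\<gamma>x / 2 = s * (sin \<theta> * cos \<theta>)"
    by (simp_all add: cos_double sin_double)
  define V :: "complex^3^3" where "V = vector [vector [cos \<theta>, 0, - sin \<theta>], vector [0, 1, 0], vector [sin \<theta>, 0, cos \<theta>]]"
  have sc: "sin \<theta> * sin \<theta> + cos \<theta> * cos \<theta> = 1" "cos \<theta> * cos \<theta> + sin \<theta> * sin \<theta> = 1"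
    by (simp_all flip: power2_eq_square)
  have 1: "adj V ** V = mat 1"
    by (simp add: V_def vec_eq_iff forall_3 matrix_matrix_mult_def adj_def sum_3 vector_3 mat_def sc flip: of_real_mult of_real_add)
  then have 2: "V ** adj V = mat 1" by (metis matrix_left_right_inverse)
  have s2: "complex_of_real (sqrt 2) * complex_of_real (sqrt 2) = 2"
    by (metis abs_numeral of_real_mult of_real_numeral real_sqrt_mult_self)
  have e: "hbar * (g + \<gamma>x / 2 + \<gamma>z) = h 1 * (cos \<theta> * cos \<theta>) + h 3 * (sin \<theta> * sin \<theta>)"
    "hbar * (- g + \<gamma>x / 2 + \<gamma>z) = h 1 * (sin \<theta> * sin \<theta>) + h 3 * (cos \<theta> * cos \<theta>)"
    "hbar * (\<gamma>x / 2) = h 1 * (sin \<theta> * cos \<theta>) - h 3 * (sin \<theta> * cos \<theta>)"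
    "hbar * \<gamma>x = h 2"
  proof -
    have id: "h 1 * (C * C) + h 3 * (S * S) = hbar * ((\<gamma>x / 2 + \<gamma>z) * (S * S + C * C) + s / 2 * (C\<^sup>2 - S\<^sup>2))" for C S
      by (simp add: h_def algebra_simps power2_eq_square)
    show "hbar * (g + \<gamma>x / 2 + \<gamma>z) = h 1 * (cos \<theta> * cos \<theta>) + h 3 * (sin \<theta> * sin \<theta>)"
      unfolding id sc g[symmetric] by simp
    have "s / 2 * ((sin \<theta>)\<^sup>2 - (cos \<theta>)\<^sup>2) = - g"
      unfolding g by (simp add: algebra_simps)
    then show "hbar * (- g + \<gamma>x / 2 + \<gamma>z) = h 1 * (sin \<theta> * sin \<theta>) + h 3 * (cos \<theta> * cos \<theta>)"
      unfolding id sc by simp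
    show "hbar * (\<gamma>x / 2) = h 1 * (sin \<theta> * cos \<theta>) - h 3 * (sin \<theta> * cos \<theta>)"
      using x by (simp add: h_def algebra_simps)
  qed (simp add: h_def)
  have "hamiltonian hbar g \<gamma>x \<gamma>z = vector [vector [complex_of_real (hbar * (g + \<gamma>x / 2 + \<gamma>z)), 0, complex_of_real (hbar * (\<gamma>x / 2))],
    vector [0, complex_of_real (hbar * \<gamma>x), 0],
    vector [complex_of_real (hbar * (\<gamma>x / 2)), 0, complex_of_real (hbar * (- g + \<gamma>x / 2 + \<gamma>z))]]"
    using s2 by (simp add: hamiltonian_def vec_eq_iff forall_3 spin_x_def spin_z_def matrix_matrix_mult_def sum_3 vector_3
       scaleR_conv_of_real[where 'a=complex] field_simps)
  also have "\<dots> = V ** diag_mat (\<lambda>k. complex_of_real (h k)) ** adj V"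
    unfolding e by (simp add: vec_eq_iff forall_3 diag_mat_conj_entry V_def sum_3 vector_3 mult_ac)
  finally show thesis using that[OF 1 2] by blast
qed

lemma det_charpoly_diag:
  fixes V :: "complex^3^3"
  assumes "V ** adj V = mat 1"
  shows "det (mat x - V ** diag_mat d ** adj V) = (x - d 1) * (x - d 2) * (x - d 3)"
proof -
  have "(V ** mat x ** adj V) $ i $ j = (mat x :: complex^3^3) $ i $ j" for i j
  proof -
    have "(V ** mat x ** adj V) $ i $ j = x * (V ** adj V) $ i $ j"
      by (simp add: matrix_matrix_mult_def[of "V ** mat x"] mat_mult_entry matrix_matrix_mult_def[of V "adj V"]
          sum_distrib_left mult_ac)
    then show ?thesis unfolding assms by (simp add: mat_def)
  qed
  then have "V ** mat x ** adj V = mat x" by (simp add: vec_eq_iff)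
  moreover have "V ** (mat x - diag_mat d) ** adj V = V ** mat x ** adj V - V ** diag_mat d ** adj V"
    by (simp add: vec_eq_iff matrix_matrix_mult_def sum_subtractf algebra_simps)
  ultimately have "det (mat x - V ** diag_mat d ** adj V) = det V * det (mat x - diag_mat d) * det (adj V)"
    by (metis det_mul)
  also have "\<dots> = det (V ** adj V) * det (mat x - diag_mat d)" by (simp add: det_mul)
  also have "\<dots> = (x - d 1) * (x - d 2) * (x - d 3)"
    unfolding assms by (simp add: det_3 diag_mat_def mat_def)
  finally show ?thesis .
qed

text \<open>The criterion sees the eigenvalues only through
  \<open>2 * e3 - e1 - e2 = 3 * e3 - (e1 + e2 + e3)\<close>, so their sum and minimum suffice and
  the \<open>h k\<close> can stay unsorted.\<close>

lemma ordered_eigenvalues_diag: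
  fixes V :: "complex^3^3"
  assumes V: "V ** adj V = mat 1"
    and ev: "ordered_eigenvalues (V ** diag_mat (\<lambda>k. complex_of_real (h k)) ** adj V) e1 e2 e3"
  shows "e1 + e2 + e3 = h 1 + h 2 + h 3" "e3 = Min (range h)"
proof -
  have "(complex_of_real x - h 1) * (complex_of_real x - h 2) * (complex_of_real x - h 3)
      = (complex_of_real x - e1) * (complex_of_real x - e2) * (complex_of_real x - e3)" for x
    using ev by (simp add: ordered_eigenvalues_def det_charpoly_diag[OF V])
  then have eq: "(x - h 1) * (x - h 2) * (x - h 3) = (x - e1) * (x - e2) * (x - e3)" for x
    by (simp only: of_real_eq_iff flip: of_real_diff of_real_mult)
  \<comment> \<open>Adding the values at 1 and -1 and subtracting twice that at 0 isolates twice the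
    quadratic coefficient, which is minus the sum of the roots.\<close>
  show "e1 + e2 + e3 = h 1 + h 2 + h 3"
    using eq[of 0] eq[of 1] eq[of "-1"] by (simp add: algebra_simps)
  have le: "e3 \<le> e2" "e2 \<le> e1" using ev by (simp_all add: ordered_eigenvalues_def)
  show "e3 = Min (range h)"
  proof (rule Min_eqI[symmetric])
    have "e3 = h 1 \<or> e3 = h 2 \<or> e3 = h 3" using eq[of e3] by auto
    then show "e3 \<in> range h" by auto
    show "e3 \<le> y" if y: "y \<in> range h" for y
    proof -
      obtain k where "y = h k" using y by blast
      then have "(y - e1) * (y - e2) * (y - e3) = 0"
        using eq[of y] exhaust_3[of k] by auto
      then show ?thesis using le by auto
    qed
  qed simp
qed

section \<open>The criterion, its explicit cases and the critical temperature\<close>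

theorem mainTheorem5:
  fixes hbar kB g \<gamma>x \<gamma>z :: real
  assumes "hbar > 0" and "kB > 0" and "g \<ge> 0"
  shows
    "(\<forall>\<epsilon>1 \<epsilon>2 \<epsilon>3 T.
        ordered_eigenvalues (hamiltonian hbar g \<gamma>x \<gamma>z) \<epsilon>1 \<epsilon>2 \<epsilon>3 \<and> T > 0 \<longrightarrow>
        (let C = (2 * \<epsilon>3 - \<epsilon>1 - \<epsilon>2 + 2 * kB * T * ln 2 \<ge> 0) in
          (sym_abs_separable (thermal_state (hamiltonian hbar g \<gamma>x \<gamma>z) kB T) \<longleftrightarrow> C) \<and>
          (g = 0 \<longrightarrow>
            (\<gamma>x \<le> 0 \<and> \<gamma>z \<le> 0 \<longrightarrow>
              (C \<longleftrightarrow> hbar * (\<gamma>x + \<gamma>z) + 2 * kB * T * ln 2 \<ge> 0)) \<and>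
            ((0 \<le> \<gamma>z \<and> \<gamma>z \<le> \<gamma>x) \<or> (\<gamma>z \<le> 0 \<and> 0 \<le> \<gamma>x) \<longrightarrow>
              (C \<longleftrightarrow> hbar * (\<gamma>z - 2 * \<gamma>x) + 2 * kB * T * ln 2 \<ge> 0)) \<and>
            ((0 \<le> \<gamma>x \<and> \<gamma>x \<le> \<gamma>z) \<or> (\<gamma>x \<le> 0 \<and> 0 \<le> \<gamma>z) \<longrightarrow>
              (C \<longleftrightarrow> hbar * (\<gamma>x - 2 * \<gamma>z) + 2 * kB * T * ln 2 \<ge> 0))) \<and>
          (g \<noteq> 0 \<longrightarrow>
            (g\<^sup>2 \<le> \<gamma>z * (\<gamma>z - \<gamma>x) \<and> \<gamma>x < 2 * \<gamma>z \<longrightarrow>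
              (C \<longleftrightarrow> hbar * (\<gamma>x - 2 * \<gamma>z) + 2 * kB * T * ln 2 \<ge> 0)) \<and>
            (g\<^sup>2 \<ge> \<gamma>z * (\<gamma>z - \<gamma>x) \<or> 2 * \<gamma>z < \<gamma>x \<longrightarrow>
              (C \<longleftrightarrow> hbar * (2 * \<gamma>z - \<gamma>x - 3 * sqrt (4 * g\<^sup>2 + \<gamma>x\<^sup>2))
                      + 4 * kB * T * ln 2 \<ge> 0))))) \<and>
     (\<exists>Tc\<ge>0. \<forall>T>0.
        (T > Tc \<longrightarrow> sym_abs_separable (thermal_state (hamiltonian hbar g \<gamma>x \<gamma>z) kB T)) \<and>
        (T < Tc \<longrightarrow> \<not> sym_abs_separable (thermal_state (hamiltonian hbar g \<gamma>x \<gamma>z) kB T)))"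
proof -
  define s where "s = sqrt (4 * g\<^sup>2 + \<gamma>x\<^sup>2)"
  define h where "h = (\<lambda>k::3. hbar * (if k = 1 then \<gamma>z + \<gamma>x / 2 + s / 2
    else if k = 2 then \<gamma>x else \<gamma>z + \<gamma>x / 2 - s / 2))"
  let ?H = "hamiltonian hbar g \<gamma>x \<gamma>z"
  obtain V :: "complex^3^3" where V: "adj V ** V = mat 1" "V ** adj V = mat 1"
    and H: "?H = V ** diag_mat (\<lambda>k. complex_of_real (h k)) ** adj V"
    using hamiltonian_diagonalization[of hbar g \<gamma>x \<gamma>z] unfolding h_def s_def by blast
  \<comment> \<open>The least energy in units of \<open>hbar\<close>. The upper level of the outer
    block never lies below the lower one, because \<open>s\<close> is nonnegative.\<close>
  define m where "m = min \<gamma>x (\<gamma>z + \<gamma>x / 2 - s / 2)"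
  have s0: "0 \<le> s" by (simp add: s_def)
  have range_h: "range h = {h 1, h 2, h 3}"
    using exhaust_3 by (auto simp: image_iff) metis
  have m: "Min (range h) = hbar * m"
  proof -
    have "h 3 \<le> h 1" using s0 \<open>hbar > 0\<close> by (simp add: h_def)
    then have "Min (range h) = min (h 2) (h 3)" by (simp add: range_h min_def)
    then show ?thesis
      using \<open>hbar > 0\<close> by (simp add: h_def m_def min_mult_distrib_left)
  qed
  have tr: "h 1 + h 2 + h 3 = hbar * (2 * \<gamma>x + 2 * \<gamma>z)"
    by (simp add: h_def algebra_simps)
  have SAS: "sym_abs_separable (thermal_state ?H kB T)
      \<longleftrightarrow> hbar * (3 * m - 2 * \<gamma>x - 2 * \<gamma>z) + 2 * kB * T * ln 2 \<ge> 0" if "T > 0" for T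
  proof -
    \<comment> \<open>Every \<open>k\<close> gives the same lower threshold for \<open>h k\<close>,
      so the smallest energy alone decides.\<close>
    have "sym_abs_separable (thermal_state ?H kB T)
        \<longleftrightarrow> (\<forall>k. ((h 1 + h 2 + h 3) - 2 * kB * T * ln 2) / 3 \<le> h k)"
      unfolding H sym_abs_separable_thermal_iff[OF V \<open>kB > 0\<close> that] by (simp add: field_simps)
    also have "\<dots> \<longleftrightarrow> ((h 1 + h 2 + h 3) - 2 * kB * T * ln 2) / 3 \<le> Min (range h)"
      by (subst Min_ge_iff) auto
    finally show ?thesis unfolding m tr by (simp add: field_simps)
  qed
  have m_x: "m = \<gamma>x" if "s \<le> 2 * \<gamma>z - \<gamma>x"
    using that by (simp add: m_def)
  have m_s: "m = \<gamma>z + \<gamma>x / 2 - s / 2" if "2 * \<gamma>z - \<gamma>x \<le> s"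
    using that by (simp add: m_def)
  \<comment> \<open>When \<open>2 * \<gamma>z - \<gamma>x\<close> is nonnegative, this identity
    turns its comparison with \<open>s\<close> into one of \<open>g\<^sup>2\<close> with
    \<open>\<gamma>z * (\<gamma>z - \<gamma>x)\<close>: the source of the case conditions for
    nonzero \<open>g\<close>.\<close>
  have sq: "4 * g\<^sup>2 + \<gamma>x\<^sup>2 = (2 * \<gamma>z - \<gamma>x)\<^sup>2 + 4 * (g\<^sup>2 - \<gamma>z * (\<gamma>z - \<gamma>x))"
    by (simp add: power2_eq_square algebra_simps)
  have C: "(2 * \<epsilon>3 - \<epsilon>1 - \<epsilon>2 + 2 * kB * T * ln 2 \<ge> 0)
      \<longleftrightarrow> hbar * (3 * m - 2 * \<gamma>x - 2 * \<gamma>z) + 2 * kB * T * ln 2 \<ge> 0"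
    if "ordered_eigenvalues ?H \<epsilon>1 \<epsilon>2 \<epsilon>3" for \<epsilon>1 \<epsilon>2 \<epsilon>3 T
  proof -
    have "\<epsilon>1 + \<epsilon>2 + \<epsilon>3 = hbar * (2 * \<gamma>x + 2 * \<gamma>z)" "\<epsilon>3 = hbar * m"
      using ordered_eigenvalues_diag[OF V(2) that[unfolded H]] unfolding tr m .
    then have "2 * \<epsilon>3 - \<epsilon>1 - \<epsilon>2 = hbar * (3 * m - 2 * \<gamma>x - 2 * \<gamma>z)"
      by (simp add: algebra_simps)
    then show ?thesis by simp
  qed
  \<comment> \<open>For \<open>g = 0\<close> one has \<open>s = \<bar>\<gamma>x\<bar>\<close>, so
    the energies in units of \<open>hbar\<close> are \<open>\<gamma>x\<close>,
    \<open>\<gamma>z\<close> and \<open>\<gamma>x + \<gamma>z\<close>; the three cases say which of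
    them is lowest.\<close>
  have a: "3 * m - 2 * \<gamma>x - 2 * \<gamma>z = \<gamma>x + \<gamma>z" if "g = 0" "\<gamma>x \<le> 0 \<and> \<gamma>z \<le> 0"
    using that by (simp add: m_def s_def min_def)
  have b: "3 * m - 2 * \<gamma>x - 2 * \<gamma>z = \<gamma>z - 2 * \<gamma>x"
    if "g = 0" "(0 \<le> \<gamma>z \<and> \<gamma>z \<le> \<gamma>x) \<or> (\<gamma>z \<le> 0 \<and> 0 \<le> \<gamma>x)"
    using that by (auto simp: m_def s_def min_def)
  have c: "3 * m - 2 * \<gamma>x - 2 * \<gamma>z = \<gamma>x - 2 * \<gamma>z"
    if "g = 0" "(0 \<le> \<gamma>x \<and> \<gamma>x \<le> \<gamma>z) \<or> (\<gamma>x \<le> 0 \<and> 0 \<le> \<gamma>z)"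
    using that by (auto simp: m_def s_def min_def)
  have d: "3 * m - 2 * \<gamma>x - 2 * \<gamma>z = \<gamma>x - 2 * \<gamma>z"
    if "g\<^sup>2 \<le> \<gamma>z * (\<gamma>z - \<gamma>x) \<and> \<gamma>x < 2 * \<gamma>z"
  proof -
    have "s \<le> 2 * \<gamma>z - \<gamma>x"
      unfolding s_def by (rule real_le_lsqrt) (use that in \<open>simp_all add: sq\<close>)
    then show ?thesis using m_x by simp
  qed
  have e: "hbar * (3 * m - 2 * \<gamma>x - 2 * \<gamma>z) + 2 * kB * T * ln 2 \<ge> 0
      \<longleftrightarrow> hbar * (2 * \<gamma>z - \<gamma>x - 3 * sqrt (4 * g\<^sup>2 + \<gamma>x\<^sup>2)) + 4 * kB * T * ln 2 \<ge> 0"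
    if "g\<^sup>2 \<ge> \<gamma>z * (\<gamma>z - \<gamma>x) \<or> 2 * \<gamma>z < \<gamma>x" for T
  proof -
    \<comment> \<open>In the second alternative the left side is negative, while \<open>s\<close> is
      not.\<close>
    have "2 * \<gamma>z - \<gamma>x \<le> s"
      using that
    proof
      assume "g\<^sup>2 \<ge> \<gamma>z * (\<gamma>z - \<gamma>x)"
      then show ?thesis unfolding s_def by (intro real_le_rsqrt) (simp add: sq)
    qed (use s0 in linarith)
    then have "m = \<gamma>z + \<gamma>x / 2 - s / 2" by (rule m_s)
    \<comment> \<open>The explicit form is twice the general one, which clears the halves in
      \<open>m\<close>.\<close>
    then have "hbar * (2 * \<gamma>z - \<gamma>x - 3 * s) + 4 * kB * T * ln 2
        = 2 * (hbar * (3 * m - 2 * \<gamma>x - 2 * \<gamma>z) + 2 * kB * T * ln 2)"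
      by (simp only:) (simp add: algebra_simps)
    then show ?thesis unfolding s_def[symmetric] by (simp only: zero_le_mult_iff) simp
  qed
  \<comment> \<open>The temperature at which the criterion becomes an equality. It is nonnegative
    because three times the least energy is at most the trace of the Hamiltonian; if it is 0, the
    claim about lower temperatures is vacuous.\<close>
  define Tc where "Tc = hbar * (2 * \<gamma>x + 2 * \<gamma>z - 3 * m) / (2 * kB * ln 2)"
  have "3 * m \<le> 2 * \<gamma>x + 2 * \<gamma>z"
    using s0 by (simp add: m_def min_def)
  then have "Tc \<ge> 0" using assms by (simp add: Tc_def)
  moreover have "sym_abs_separable (thermal_state ?H kB T) \<longleftrightarrow> Tc \<le> T" if "T > 0" for T
    unfolding SAS[OF that] Tc_def using \<open>kB > 0\<close> by (simp add: field_simps)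
  ultimately have Tc: "\<exists>Tc\<ge>0. \<forall>T>0. (T > Tc \<longrightarrow> sym_abs_separable (thermal_state ?H kB T)) \<and>
      (T < Tc \<longrightarrow> \<not> sym_abs_separable (thermal_state ?H kB T))"
    by (intro exI[of _ Tc]) auto
  show ?thesis
    unfolding Let_def
    by (intro conjI allI impI Tc) (simp_all add: C SAS a b c d e)
qed

end
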